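(* Let $m\ge 1$, let $X=(X_1,\dots,X_{m+1})$ be multivariate log-normal, $X_i=\exp(Z_i)$ with $Z\sim\mathcal{N}_{m+1}(\mu,A)$, where $\mu\in\mathbb{R}^{m+1}$ and $A$ is symmetric positive definite with inverse $B=A^{-1}$. Put $b_i=\sum_{j=1}^{m+1}B_{ji}$ and $\beta=\sum_{i=1}^{m+1}b_i$. Let $u=(u_1,\dots,u_{m+1})$ with $u_i>0$ for all $i$, and let $q_\alpha(u)$ denote the $\alpha$-quantile of $\sum_{i=1}^{m+1}u_iX_i$. The following are true. (1) Assume $b_i>0$ for all $i=1,\dots,m+1$. If $\alpha_0\in(0,1)$ is such that $$q_{\alpha_0}(u)<\eta\exp\Big(\frac1\beta\Big(\sum_{j=1}^{m+1}(B\mu)_j+1\Big)\Big)$$ for some $0<\eta<\min\{u_1,\dots,u_{m+1}\}$, then $q_\alpha$ is strictly concave at $u$ for all $0<\alpha\le\alpha_0$. (2) Let $m=1$ and $b_2<0$. Then there exists an $\alpha_0>0$ such that $q_\alpha$ is concave at $u$ for all $0<\alpha\le\alpha_0$.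
   Context: For $\alpha\in(0,1)$ and $u\in(0,\infty)^{m+1}$, $q_\alpha(u)=\inf\{y\in\mathbb{R}:P(\sum_{i=1}^{m+1}u_iX_i\le y)\ge\alpha\}$, regarded as a function of $u$ at fixed $\alpha$. Concavity is understood pointwise through the Hessian in $u$: $q_\alpha$ is concave at $u$ if $\langle v,\frac{\delta^2q_\alpha}{\delta u^2}(u)v\rangle\le 0$ for all $v\in\mathbb{R}^{m+1}$, and strictly concave at $u$ if moreover this inequality is strict for all $v\in\mathbb{R}^{m+1}$ that are not multiples of $u$ (since $q_\alpha$ is positively homogeneous of degree one, its Hessian always annihilates $u$). *)

theory Defs
  imports "HOL-Probability.Probability"
begin

definition sym_pos_def :: "real ^ 'n ^ 'n \<Rightarrow> bool" where
  "sym_pos_def A \<longleftrightarrow> transpose A = A \<and> (\<forall>v. v \<noteq> 0 \<longrightarrow> v \<bullet> (A *v v) > 0)"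

(* Lebesgue density of the normal law N(mu, A), meant for positive definite A *)
definition mvn_density :: "real ^ 'n \<Rightarrow> real ^ 'n ^ 'n \<Rightarrow> real ^ 'n \<Rightarrow> real" where
  "mvn_density \<mu> A z =
     exp (- ((z - \<mu>) \<bullet> (matrix_inv A *v (z - \<mu>))) / 2) / sqrt ((2 * pi) ^ CARD('n) * det A)"

definition quantile :: "'a measure \<Rightarrow> ('a \<Rightarrow> real) \<Rightarrow> real \<Rightarrow> real" where
  "quantile M Y \<alpha> = Inf {y. measure M {\<omega> \<in> space M. Y \<omega> \<le> y} \<ge> \<alpha>}"

(* H is the derivative at u of the gradient g, which must exist on a neighbourhood of u.
   Being a relation, it entails that f is twice differentiable at u. *)
definition has_hessian :: "(real ^ 'n \<Rightarrow> real) \<Rightarrow> real ^ 'n ^ 'n \<Rightarrow> real ^ 'n \<Rightarrow> bool" where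
  "has_hessian f H u \<longleftrightarrow>
     (\<exists>g. (\<forall>\<^sub>F x in nhds u. GDERIV f x :> g x) \<and> (g has_derivative (\<lambda>v. H *v v)) (at u))"

definition concave_at :: "(real ^ 'n \<Rightarrow> real) \<Rightarrow> real ^ 'n \<Rightarrow> bool" where
  "concave_at f u \<longleftrightarrow> (\<exists>H. has_hessian f H u \<and> (\<forall>v. v \<bullet> (H *v v) \<le> 0))"

(* Strictness is only asked for off the line through u: the Hessian of a function
   that is positively homogeneous of degree one annihilates u. *)
definition strictly_concave_at :: "(real ^ 'n \<Rightarrow> real) \<Rightarrow> real ^ 'n \<Rightarrow> bool" where
  "strictly_concave_at f u \<longleftrightarrow>
     (\<exists>H. has_hessian f H u \<and> (\<forall>v. v \<bullet> (H *v v) \<le> 0) \<and>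
          (\<forall>v. (\<nexists>c. v = c *\<^sub>R u) \<longrightarrow> v \<bullet> (H *v v) < 0))"

end

theory Submission
  imports Defs
begin

text \<open>
  Fix a vector \<open>a\<close> with positive entries and split \<open>Z = R + s a\<close>, where \<open>s = (B a) \<bullet> Z / \<beta>\<close>,
  \<open>\<beta> = a \<bullet> B a\<close>, is a normal variable of variance \<open>1 / \<beta>\<close> independent of \<open>R\<close>. As \<open>a\<close> is positive,
  \<open>\<Sum> exp (l\<^sub>i + R\<^sub>i + s a\<^sub>i) \<le> 1\<close> means \<open>s \<le> \<tau> (l + R)\<close> for a smooth function \<open>\<tau>\<close>, so that
  \<open>P (\<Sum> u\<^sub>i X\<^sub>i \<le> y)\<close> is the mean over \<open>R\<close> of the normal distribution function at \<open>\<tau> (l + R)\<close>,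
  \<open>l\<^sub>i = ln u\<^sub>i - ln y\<close>. All derivatives involved are bounded, which permits differentiation
  under the integral, and the quantile is an implicit function whose Hessian is an average over \<open>R\<close>
  of an explicit quadratic expression.

  In part (1) take \<open>a = (1, \<dots>, 1)\<close>: the expression is a square times
  \<open>\<beta> (\<tau> - E s) - 1\<close>, and \<open>B a \<bullet> R = 0\<close>, \<open>B a = b > 0\<close> yield
  \<open>\<beta> \<tau> \<le> \<Sum> b\<^sub>i (ln q - ln u\<^sub>i)\<close>.

  In part (2) take for \<open>a\<close> the column \<open>A e\<^sub>i\<close> with \<open>i \<noteq> k\<close>; it is positive because \<open>b\<^sub>k < 0\<close> forces
  \<open>B\<^sub>k\<^sub>i < 0\<close>. Now \<open>B a = e\<^sub>i\<close>, hence \<open>R\<^sub>i = 0\<close> and \<open>\<beta> \<tau> \<le> ln q - ln u\<^sub>i\<close>, which tends to minus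
  infinity with \<open>\<alpha>\<close> and dominates the remaining bounded coefficients.
\<close>

section \<open>Implicit functions and differentiation under the integral\<close>

text \<open>Implicit differentiation at a single point, with a Lipschitz bound on \<open>T\<close>
  in place of the implicit function theorem. On the level set, \<open>F'\<close> of the displacement
  is of smaller order than the displacement, which is itself of order
  \<open>norm (x - r)\<close>.\<close>

lemma has_derivative_implicit_shift:
  fixes F :: "'a::real_normed_vector \<Rightarrow> real"
  assumes F: "(F has_derivative F') (at (r + T r *\<^sub>R a))"
    and nz: "F' a \<noteq> 0"
    and lip: "\<And>x. \<bar>T x - T r\<bar> \<le> L * norm (x - r)"
    and level: "\<And>x. F (x + T x *\<^sub>R a) = c"
  shows "(T has_derivative (\<lambda>h. - F' h / F' a)) (at r)"
proof -
  define p where "p = r + T r *\<^sub>R a"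
  have blF: "bounded_linear F'" using F by (rule has_derivative_bounded_linear)
  interpret F': bounded_linear F' by (rule blF)
  \<comment> \<open>The point \<open>x + T x *\<^sub>R a\<close> moves at most \<open>K\<close>
    times as far as \<open>x\<close>; \<open>L\<close> carries no sign condition, hence the absolute
    value.\<close>
  define K where "K = 1 + \<bar>L\<bar> * norm a"
  have K: "K > 0" unfolding K_def by (smt (verit) mult_nonneg_nonneg norm_ge_zero)
  have step: "norm (x + T x *\<^sub>R a - p) \<le> K * norm (x - r)" for x
  proof -
    have "x + T x *\<^sub>R a - p = (x - r) + (T x - T r) *\<^sub>R a"
      by (simp add: p_def algebra_simps)
    then have "norm (x + T x *\<^sub>R a - p) \<le> norm (x - r) + \<bar>T x - T r\<bar> * norm a"
      by (metis norm_scaleR norm_triangle_ineq)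
    also have "\<dots> \<le> norm (x - r) + (\<bar>L\<bar> * norm (x - r)) * norm a"
      using lip[of x] by (intro add_left_mono mult_right_mono)
        (auto intro: order_trans[OF _ mult_right_mono[of L "\<bar>L\<bar>"]])
    also have "\<dots> = K * norm (x - r)" by (simp add: K_def algebra_simps)
    finally show ?thesis .
  qed
  show ?thesis
    unfolding has_derivative_at_alt
  proof (intro conjI allI impI)
    show "bounded_linear (\<lambda>h. - F' h / F' a)"
      using bounded_linear_compose[OF bounded_linear_mult_right blF, of "- 1 / F' a"]
      by simp
    fix e :: real assume e: "e > 0"
    \<comment> \<open>Chosen so that \<open>e' * K\<close> equals
      \<open>e * \<bar>F' a\<bar>\<close>, from which \<open>F' a\<close> is cancelled at the
      end.\<close>
    define e' where "e' = e * \<bar>F' a\<bar> / K"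
    have e': "e' > 0" using e nz K by (simp add: e'_def)
    then obtain d where d: "d > 0"
      and dF: "\<And>y. norm (y - p) < d \<Longrightarrow> norm (F y - F p - F' (y - p)) \<le> e' * norm (y - p)"
      using F unfolding has_derivative_at_alt p_def[symmetric] by blast
    show "\<exists>d>0. \<forall>y. norm (y - r) < d \<longrightarrow>
        norm (T y - T r - - F' (y - r) / F' a) \<le> e * norm (y - r)"
    proof (intro exI[of _ "d / K"] conjI allI impI)
      show "d / K > 0" using d K by simp
      fix y assume y: "norm (y - r) < d / K"
      have "norm (y + T y *\<^sub>R a - p) < d"
        using step[of y] y K by (simp add: field_simps)
      from dF[OF this] have "norm (F' (y + T y *\<^sub>R a - p)) \<le> e' * norm (y + T y *\<^sub>R a - p)"
        using level[of y] level[of r] by (simp add: p_def)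
      also have "\<dots> \<le> e' * (K * norm (y - r))"
        using step[of y] e' by (intro mult_left_mono) auto
      also have "\<dots> = \<bar>F' a\<bar> * (e * norm (y - r))" using K by (simp add: e'_def)
      finally have *: "norm (F' (y + T y *\<^sub>R a - p)) \<le> \<bar>F' a\<bar> * (e * norm (y - r))" .
      have "y + T y *\<^sub>R a - p = (y - r) + (T y - T r) *\<^sub>R a"
        by (simp add: p_def algebra_simps)
      then have "F' (y + T y *\<^sub>R a - p) = F' (y - r) + (T y - T r) * F' a"
        by (simp only: F'.add F'.scaleR real_scaleR_def)
      also have "\<dots> = F' a * (T y - T r - - F' (y - r) / F' a)"
        using nz by (simp add: field_simps)
      finally have "\<bar>F' a\<bar> * norm (T y - T r - - F' (y - r) / F' a) \<le> \<bar>F' a\<bar> * (e * norm (y - r))"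
        using * by (simp add: abs_mult)
      then show "norm (T y - T r - - F' (y - r) / F' a) \<le> e * norm (y - r)"
        using nz by simp
    qed
  qed
qed

text \<open>If \<open>T y - T x\<close> exceeded \<open>norm (x - y) / \<kappa>\<close>, the shifted
  \<open>y\<close> would lie strictly above the shifted \<open>x\<close> in every coordinate, and a
  strictly increasing \<open>F\<close> could not agree on them.\<close>

lemma lipschitz_implicit_shift:
  fixes F :: "real ^ 'n \<Rightarrow> real"
  assumes mono: "\<And>x y. (\<And>i. x $ i < y $ i) \<Longrightarrow> F x < F y"
    and \<kappa>: "\<kappa> > 0" "\<And>i. a $ i \<ge> \<kappa>"
    and level: "\<And>x. F (x + T x *\<^sub>R a) = c"
  shows "\<bar>T x - T y\<bar> \<le> 1 / \<kappa> * norm (x - y)"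
proof -
  have "T y - T x \<le> norm (x - y) / \<kappa>" for x y
  proof (rule ccontr)
    assume "\<not> T y - T x \<le> norm (x - y) / \<kappa>"
    then have less: "norm (x - y) < (T y - T x) * \<kappa>" using \<kappa> by (simp add: field_simps)
    have "(x + T x *\<^sub>R a) $ i < (y + T y *\<^sub>R a) $ i" for i
    proof -
      have "x $ i - y $ i \<le> norm (x - y)"
        using component_le_norm_cart[of "x - y" i] by simp
      moreover have "0 < T y - T x" using less \<kappa>(1)
        by (smt (verit) norm_ge_zero mult_nonneg_nonneg zero_less_mult_pos2)
      then have "(T y - T x) * \<kappa> \<le> (T y - T x) * a $ i"
        using \<kappa> by (intro mult_left_mono) auto
      ultimately show ?thesis using less by (simp add: algebra_simps)
    qed
    from mono[OF this] level show False by simp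
  qed
  from this[of x y] this[of y x] show ?thesis
    by (simp add: abs_if norm_minus_commute)
qed

section \<open>Bounded functions with bounded derivative, and integrals of their translates\<close>

text \<open>The bound on \<open>f\<close> makes its translates integrable over a probability space,
  the bound on \<open>f'\<close> supplies the dominating function. The derivative is an argument
  because its explicit formula enters the Hessian.\<close>

definition bounded_C1 :: "('a::real_normed_vector \<Rightarrow> real) \<Rightarrow> ('a \<Rightarrow> 'a \<Rightarrow> real) \<Rightarrow> bool" where
  "bounded_C1 f f' \<longleftrightarrow> (\<forall>x. (f has_derivative f' x) (at x)) \<and>
     (\<exists>C. \<forall>x. \<bar>f x\<bar> \<le> C) \<and> (\<exists>C. \<forall>x h. \<bar>f' x h\<bar> \<le> C * norm h)"

lemma bounded_C1I:
  assumes "\<And>x. (f has_derivative f' x) (at x)" "\<And>x. \<bar>f x\<bar> \<le> C"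
    "\<And>x h. \<bar>f' x h\<bar> \<le> C' * norm h"
  shows "bounded_C1 f f'"
  using assms unfolding bounded_C1_def by blast

lemma bounded_C1_add:
  assumes "bounded_C1 f f'" "bounded_C1 g g'"
  shows "bounded_C1 (\<lambda>x. f x + g x) (\<lambda>x h. f' x h + g' x h)"
proof -
  obtain A A' B B' where *: "\<And>x. \<bar>f x\<bar> \<le> A" "\<And>x h. \<bar>f' x h\<bar> \<le> A' * norm h"
    "\<And>x. \<bar>g x\<bar> \<le> B" "\<And>x h. \<bar>g' x h\<bar> \<le> B' * norm h"
    using assms unfolding bounded_C1_def by blast
  show ?thesis
  proof (rule bounded_C1I[where C = "A + B" and C' = "A' + B'"])
    show "((\<lambda>x. f x + g x) has_derivative (\<lambda>h. f' x h + g' x h)) (at x)" for x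
      using assms unfolding bounded_C1_def by (intro has_derivative_add) auto
    show "\<bar>f x + g x\<bar> \<le> A + B" for x using *(1)[of x] *(3)[of x] by linarith
    show "\<bar>f' x h + g' x h\<bar> \<le> (A' + B') * norm h" for x h
      using *(2)[of x h] *(4)[of x h] by (simp add: algebra_simps)
  qed
qed

lemma bounded_C1_mult:
  assumes "bounded_C1 f f'" "bounded_C1 g g'"
  shows "bounded_C1 (\<lambda>x. f x * g x) (\<lambda>x h. f x * g' x h + f' x h * g x)"
proof -
  obtain A A' B B' where *: "\<And>x. \<bar>f x\<bar> \<le> A" "\<And>x h. \<bar>f' x h\<bar> \<le> A' * norm h"
    "\<And>x. \<bar>g x\<bar> \<le> B" "\<And>x h. \<bar>g' x h\<bar> \<le> B' * norm h"
    using assms unfolding bounded_C1_def by blast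
  show ?thesis
  proof (rule bounded_C1I[where C = "A * B" and C' = "A * B' + A' * B"])
    show "((\<lambda>x. f x * g x) has_derivative (\<lambda>h. f x * g' x h + f' x h * g x)) (at x)" for x
      using assms unfolding bounded_C1_def by (intro has_derivative_mult) auto
    show "\<bar>f x * g x\<bar> \<le> A * B" for x
      unfolding abs_mult by (intro mult_mono' * abs_ge_zero)
    show "\<bar>f x * g' x h + f' x h * g x\<bar> \<le> (A * B' + A' * B) * norm h" for x h
    proof -
      have "\<bar>f x * g' x h + f' x h * g x\<bar> \<le> \<bar>f x\<bar> * \<bar>g' x h\<bar> + \<bar>f' x h\<bar> * \<bar>g x\<bar>"
        using abs_triangle_ineq[of "f x * g' x h" "f' x h * g x"] by (simp add: abs_mult)
      also have "\<dots> \<le> A * (B' * norm h) + (A' * norm h) * B"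
        by (intro add_mono mult_mono' * abs_ge_zero)
      finally show ?thesis by (simp add: algebra_simps)
    qed
  qed
qed

lemma bounded_C1_const: "bounded_C1 (\<lambda>x. c) (\<lambda>x h. 0)"
  by (rule bounded_C1I[where C = "\<bar>c\<bar>" and C' = 0]) auto

lemma bounded_C1_sum:
  assumes "finite I" "\<And>i. i \<in> I \<Longrightarrow> bounded_C1 (f i) (f' i)"
  shows "bounded_C1 (\<lambda>x. \<Sum>i\<in>I. f i x) (\<lambda>x h. \<Sum>i\<in>I. f' i x h)"
  using assms by (induction I rule: finite_induct) (auto intro: bounded_C1_const bounded_C1_add)

lemma bounded_C1_inverse:
  assumes f: "bounded_C1 f f'" and \<kappa>: "\<kappa> > 0" "\<And>x. f x \<ge> \<kappa>"
  shows "bounded_C1 (\<lambda>x. inverse (f x)) (\<lambda>x h. - (inverse (f x) * f' x h * inverse (f x)))"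
proof -
  obtain A' where *: "\<And>x h. \<bar>f' x h\<bar> \<le> A' * norm h"
    using f unfolding bounded_C1_def by blast
  have inv: "\<bar>inverse (f x)\<bar> \<le> inverse \<kappa>" for x
    using \<kappa>(1) \<kappa>(2)[of x] by (simp add: le_imp_inverse_le abs_of_pos)
  have pos: "f x > 0" for x using \<kappa>(1) \<kappa>(2)[of x] by linarith
  show ?thesis
  proof (rule bounded_C1I[where C = "inverse \<kappa>" and C' = "inverse \<kappa> * A' * inverse \<kappa>"])
    show "((\<lambda>x. inverse (f x)) has_derivative
        (\<lambda>h. - (inverse (f x) * f' x h * inverse (f x)))) (at x)" for x
      using f pos[of x] unfolding bounded_C1_def
      by (intro Deriv.has_derivative_inverse) auto
    show "\<bar>inverse (f x)\<bar> \<le> inverse \<kappa>" for x by (rule inv)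
    show "\<bar>- (inverse (f x) * f' x h * inverse (f x))\<bar>
        \<le> inverse \<kappa> * A' * inverse \<kappa> * norm h" for x h
    proof -
      have "\<bar>inverse (f x)\<bar> * \<bar>f' x h\<bar> * \<bar>inverse (f x)\<bar>
          \<le> inverse \<kappa> * (A' * norm h) * inverse \<kappa>"
        by (intro mult_mono' inv * abs_ge_zero mult_nonneg_nonneg)
      then show ?thesis by (simp add: abs_mult mult.assoc) (simp add: ac_simps)
    qed
  qed
qed

text \<open>The derivative may be discontinuous, but in a fixed direction it is a pointwise limit of
  difference quotients of a continuous function.\<close>

lemma borel_measurable_has_derivative:
  fixes f :: "'a::euclidean_space \<Rightarrow> real"
  assumes f: "\<And>x. (f has_derivative f' x) (at x)"
  shows "(\<lambda>x. f' x h) \<in> borel_measurable borel"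
proof (rule borel_measurable_LIMSEQ_real)
  have cont: "continuous_on UNIV f"
    using f by (intro continuous_at_imp_continuous_on) (auto intro: has_derivative_continuous)
  have [measurable]: "f \<in> borel_measurable borel"
    using cont by (rule borel_measurable_continuous_onI)
  show "(\<lambda>x. (f (x + inverse (real (Suc n)) *\<^sub>R h) - f x) / inverse (real (Suc n)))
      \<in> borel_measurable borel" for n by measurable
  fix x :: 'a
  have "((\<lambda>t. f (x + t *\<^sub>R h)) has_real_derivative f' x h) (at 0)"
  proof -
    have "((\<lambda>t::real. f (x + t *\<^sub>R h)) has_derivative (\<lambda>t. f' x (t *\<^sub>R h))) (at 0)"
      by (rule has_derivative_compose[where f = "\<lambda>t::real. x + t *\<^sub>R h"])
        (auto intro!: derivative_eq_intros f)
    moreover have "(\<lambda>t. f' x (t *\<^sub>R h)) = (\<lambda>t. f' x h * t)"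
      using has_derivative_bounded_linear[OF f[of x]]
      by (auto simp: bounded_linear.linear linear_cmul)
    ultimately show ?thesis by (simp add: has_field_derivative_def)
  qed
  then have "((\<lambda>t. (f (x + t *\<^sub>R h) - f x) / t) \<longlongrightarrow> f' x h) (at 0)"
    by (simp add: DERIV_def)
  then have "((\<lambda>t. (f (x + t *\<^sub>R h) - f x) / t) \<circ> (\<lambda>n. inverse (real (Suc n)))) \<longlonglongrightarrow> f' x h"
    unfolding tendsto_at_iff_sequentially using LIMSEQ_inverse_real_of_nat by auto
  then show "(\<lambda>n. (f (x + inverse (real (Suc n)) *\<^sub>R h) - f x) / inverse (real (Suc n)))
      \<longlonglongrightarrow> f' x h" by (simp add: comp_def)
qed

text \<open>By the mean value inequality the remainder divided by the length of the increment is at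
  most \<open>2 * C\<close>, and it tends to zero pointwise, so dominated convergence carries the
  Frechet derivative through the integral.\<close>

lemma has_derivative_integral_translate:
  fixes f :: "'a::euclidean_space \<Rightarrow> real"
  assumes N: "prob_space N" and R[measurable]: "R \<in> borel_measurable N"
    and C1: "bounded_C1 f f'"
  shows "((\<lambda>l. \<integral>z. f (l + R z) \<partial>N) has_derivative (\<lambda>h. \<integral>z. f' (l + R z) h \<partial>N)) (at l)"
    and "integrable N (\<lambda>z. f (l + R z))"
    and "integrable N (\<lambda>z. f' (l + R z) h)"
proof -
  interpret prob_space N by (rule N)
  have f: "\<And>x. (f has_derivative f' x) (at x)" using C1 by (auto simp: bounded_C1_def)
  obtain A C where fA: "\<And>x. \<bar>f x\<bar> \<le> A" and fC: "\<And>x h. \<bar>f' x h\<bar> \<le> C * norm h"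
    using C1 unfolding bounded_C1_def by blast
  have cont: "continuous_on UNIV f"
    using f by (intro continuous_at_imp_continuous_on) (auto intro: has_derivative_continuous)
  have [measurable]: "f \<in> borel_measurable borel"
    using cont by (rule borel_measurable_continuous_onI)
  have [measurable]: "(\<lambda>x. f' x h) \<in> borel_measurable borel" for h
    using borel_measurable_has_derivative[OF f] .
  show int: "integrable N (\<lambda>z. f (l + R z))" for l
    by (rule integrable_const_bound[where B = A]) (auto simp: fA)
  have [measurable]: "(\<lambda>z. f' (l + R z) h) \<in> borel_measurable N" for l h
    by (rule measurable_compose[where f = "\<lambda>z. l + R z" and g = "\<lambda>x. f' x h" and N = borel]) auto
  show int': "integrable N (\<lambda>z. f' (l + R z) h)" for l h
    by (rule integrable_const_bound[where B = "C * norm h"]) (auto simp: fC)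
  have lin: "linear (f' x)" for x
    using has_derivative_bounded_linear[OF f[of x]] by (rule bounded_linear.linear)
  have Lip: "\<bar>f x - f y\<bar> \<le> C * norm (x - y)" for x y
  proof -
    have "norm (f x - f y) \<le> C * norm (x - y)"
    proof (rule differentiable_bound)
      show "convex (UNIV :: 'a set)" by simp
      show "(f has_derivative f' x) (at x within UNIV)" for x by (rule f)
      show "onorm (f' x) \<le> C" for x
        by (rule onorm_le) (use fC in simp)
    qed auto
    then show ?thesis by simp
  qed
  show "((\<lambda>l. \<integral>z. f (l + R z) \<partial>N) has_derivative (\<lambda>h. \<integral>z. f' (l + R z) h \<partial>N)) (at l)"
    unfolding has_derivative_iff_norm
  proof
    show "bounded_linear (\<lambda>h. \<integral>z. f' (l + R z) h \<partial>N)"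
    proof (rule bounded_linear_intro[where K = C])
      show "(\<integral>z. f' (l + R z) (x + y) \<partial>N) = (\<integral>z. f' (l + R z) x \<partial>N) + (\<integral>z. f' (l + R z) y \<partial>N)" for x y
        by (simp add: linear_add[OF lin] int')
      show "(\<integral>z. f' (l + R z) (r *\<^sub>R x) \<partial>N) = r *\<^sub>R (\<integral>z. f' (l + R z) x \<partial>N)" for r x
        by (simp add: linear_cmul[OF lin])
      show "norm (\<integral>z. f' (l + R z) x \<partial>N) \<le> norm x * C" for x
      proof -
        have "norm (\<integral>z. f' (l + R z) x \<partial>N) \<le> (\<integral>z. norm (f' (l + R z) x) \<partial>N)"
          by (rule integral_norm_bound)
        also have "\<dots> \<le> C * norm x"
          by (rule integral_le_const) (use fC int' in auto)
        finally show ?thesis by (simp add: mult.commute)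
      qed
    qed
    show "((\<lambda>y. norm ((\<integral>z. f (y + R z) \<partial>N) - (\<integral>z. f (l + R z) \<partial>N)
        - (\<integral>z. f' (l + R z) (y - l) \<partial>N)) / norm (y - l)) \<longlongrightarrow> 0) (at l)"
      \<comment> \<open>Dominated convergence speaks of sequences, so the limit is tested along
        every sequence \<open>Y\<close> tending to \<open>l\<close>.\<close>
      unfolding tendsto_at_iff_sequentially
    proof (intro allI impI)
      fix Y assume Y: "\<forall>i. Y i \<in> UNIV - {l}" "Y \<longlonglongrightarrow> l"
      let ?s = "\<lambda>n z. (f (Y n + R z) - f (l + R z) - f' (l + R z) (Y n - l)) / norm (Y n - l)"
      have "(\<lambda>n. \<integral>z. ?s n z \<partial>N) \<longlonglongrightarrow> (\<integral>z. 0 \<partial>N)"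
      proof (rule integral_dominated_convergence[where w = "\<lambda>_. 2 * C"])
        show "AE z in N. (\<lambda>n. ?s n z) \<longlonglongrightarrow> 0"
        proof (rule AE_I2)
          fix z
          have "((\<lambda>y. norm (f y - f (l + R z) - f' (l + R z) (y - (l + R z))) / norm (y - (l + R z)))
              \<longlongrightarrow> 0) (at (l + R z))"
            using f[of "l + R z"] unfolding has_derivative_iff_norm by blast
          then have "(\<lambda>n. norm (f (Y n + R z) - f (l + R z) - f' (l + R z) ((Y n + R z) - (l + R z)))
              / norm ((Y n + R z) - (l + R z))) \<longlonglongrightarrow> 0"
            unfolding tendsto_at_iff_sequentially comp_def
            by (elim allE[of _ "\<lambda>n. Y n + R z"]) (use Y in \<open>auto intro!: tendsto_add\<close>)
          then have "(\<lambda>n. norm (?s n z)) \<longlonglongrightarrow> 0" by simp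
          then show "(\<lambda>n. ?s n z) \<longlonglongrightarrow> 0" by (rule tendsto_norm_zero_cancel)
        qed
        show "AE z in N. norm (?s n z) \<le> 2 * C" for n
        proof (rule AE_I2)
          fix z
          have "\<bar>f (Y n + R z) - f (l + R z) - f' (l + R z) (Y n - l)\<bar> \<le> 2 * C * norm (Y n - l)"
            using Lip[of "Y n + R z" "l + R z"] fC[of "l + R z" "Y n - l"] by simp
          moreover have "norm (Y n - l) > 0" using Y(1) by simp
          ultimately show "norm (?s n z) \<le> 2 * C"
            by (simp add: field_simps)
        qed
      qed auto
      moreover have "(\<integral>z. ?s n z \<partial>N) = ((\<integral>z. f (Y n + R z) \<partial>N) - (\<integral>z. f (l + R z) \<partial>N)
        - (\<integral>z. f' (l + R z) (Y n - l) \<partial>N)) / norm (Y n - l)" for n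
        by (simp add: int int')
      ultimately have "(\<lambda>n. ((\<integral>z. f (Y n + R z) \<partial>N) - (\<integral>z. f (l + R z) \<partial>N)
        - (\<integral>z. f' (l + R z) (Y n - l) \<partial>N)) / norm (Y n - l)) \<longlonglongrightarrow> 0"
        by (simp only: Bochner_Integration.integral_zero)
      then have "(\<lambda>n. norm (((\<integral>z. f (Y n + R z) \<partial>N) - (\<integral>z. f (l + R z) \<partial>N)
        - (\<integral>z. f' (l + R z) (Y n - l) \<partial>N)) / norm (Y n - l))) \<longlonglongrightarrow> 0"
        by (rule tendsto_norm_zero)
      then show "((\<lambda>y. norm ((\<integral>z. f (y + R z) \<partial>N) - (\<integral>z. f (l + R z) \<partial>N)
        - (\<integral>z. f' (l + R z) (y - l) \<partial>N)) / norm (y - l)) \<circ> Y) \<longlonglongrightarrow> 0"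
        by (simp add: comp_def)
    qed
  qed
qed

section \<open>Exponential sums along a positive direction\<close>

locale positive_direction =
  fixes a :: "real ^ 'n"
  assumes a_pos: "\<And>i. a $ i > 0"
begin

text \<open>For \<open>a = 1\<close> this is minus the log-sum-exp function.\<close>

definition tau :: "real ^ 'n \<Rightarrow> real" where
  "tau r = (THE t. (\<Sum>i\<in>UNIV. exp (r $ i + t * a $ i)) = 1)"

text \<open>A probability vector on the indices, by \<open>sum_weight\<close>; for
  \<open>a = 1\<close> it is the softmax of \<open>r\<close>.\<close>

definition weight :: "real ^ 'n \<Rightarrow> 'n \<Rightarrow> real" where
  "weight r i = exp (r $ i + tau r * a $ i)"

text \<open>Also the derivative of the exponential sum in \<open>t\<close> at \<open>tau r\<close>,
  which is why it is the denominator of \<open>tau'\<close>.\<close>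

definition mean_a :: "real ^ 'n \<Rightarrow> real" where
  "mean_a r = (\<Sum>i\<in>UNIV. a $ i * weight r i)"

definition tau' :: "real ^ 'n \<Rightarrow> real ^ 'n \<Rightarrow> real" where
  "tau' r h = - (\<Sum>i\<in>UNIV. h $ i * weight r i) / mean_a r"

definition weight' :: "'n \<Rightarrow> real ^ 'n \<Rightarrow> real ^ 'n \<Rightarrow> real" where
  "weight' i r h = weight r i * (h $ i + a $ i * tau' r h)"

definition a_min :: real where "a_min = Min (range (\<lambda>i. a $ i))"

lemma a_min: "a_min > 0" "a_min \<le> a $ i"
  unfolding a_min_def using a_pos by (auto simp: Min_gr_iff intro!: Min_le)

lemma exp_sum_strict_mono:
  assumes "s < t"
  shows "(\<Sum>i\<in>UNIV. exp (r $ i + s * a $ i)) < (\<Sum>i\<in>UNIV. exp (r $ i + t * a $ i))"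
  using assms a_pos by (intro sum_strict_mono) auto

lemma tau_unique_ex: "\<exists>!t. (\<Sum>i\<in>UNIV. exp (r $ i + t * a $ i)) = 1"
proof (rule ex_ex1I)
  let ?E = "\<lambda>t. \<Sum>i\<in>UNIV. exp (r $ i + t * a $ i)"
  fix j :: 'n
  define n where "n = real CARD('n)"
  have n: "n \<ge> 1" by (simp add: n_def Suc_leI)
  \<comment> \<open>Bracket for the root: at \<open>lo\<close> each of the \<open>n\<close> terms is
    at most \<open>1 / n\<close>, at \<open>hi\<close> the term with index \<open>j\<close> alone
    equals 1.\<close>
  define lo where "lo = Min (range (\<lambda>i. (- ln n - r $ i) / a $ i))"
  define hi where "hi = - r $ j / a $ j"
  have lo: "lo \<le> (- ln n - r $ i) / a $ i" for i
    unfolding lo_def by (rule Min_le) auto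
  have "(- ln n - r $ j) / a $ j \<le> hi"
    unfolding hi_def using a_pos[of j] ln_ge_zero[OF n] by (intro divide_right_mono) linarith+
  then have "lo \<le> hi" using lo[of j] by linarith
  moreover have "?E lo \<le> 1"
  proof -
    have "r $ i + lo * a $ i \<le> - ln n" for i
      using lo[of i] a_pos[of i] by (simp add: field_simps)
    then have "?E lo \<le> (\<Sum>i\<in>(UNIV::'n set). exp (- ln n))"
      by (intro sum_mono) simp
    also have "\<dots> = 1" using n by (simp add: exp_minus n_def)
    finally show ?thesis .
  qed
  moreover have "1 \<le> ?E hi"
  proof -
    have "exp (r $ j + hi * a $ j) \<le> ?E hi"
      by (rule member_le_sum) auto
    then show ?thesis using a_pos[of j] by (simp add: hi_def)
  qed
  moreover have "continuous_on {lo..hi} ?E" by (intro continuous_intros)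
  ultimately show "\<exists>t. ?E t = 1" using IVT'[of ?E lo 1 hi] by blast
next
  fix s t
  assume "(\<Sum>i\<in>UNIV. exp (r $ i + s * a $ i)) = 1" "(\<Sum>i\<in>UNIV. exp (r $ i + t * a $ i)) = 1"
  then show "s = t"
    using exp_sum_strict_mono[of s t r] exp_sum_strict_mono[of t s r] by linarith
qed

lemma sum_weight: "(\<Sum>i\<in>UNIV. weight r i) = 1"
  unfolding weight_def tau_def by (rule theI'[OF tau_unique_ex])

text \<open>Positivity of \<open>a\<close> makes the sum increase with \<open>t\<close>, so the
  event becomes a half-line in the shift.\<close>

lemma exp_sum_le_1_iff: "(\<Sum>i\<in>UNIV. exp (r $ i + t * a $ i)) \<le> 1 \<longleftrightarrow> t \<le> tau r"
  using exp_sum_strict_mono[of t "tau r" r] exp_sum_strict_mono[of "tau r" t r] sum_weight[of r]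
  unfolding weight_def by (cases t "tau r" rule: linorder_cases) auto

lemma weight_pos: "weight r i > 0"
  by (simp add: weight_def)

lemma weight_le_1: "weight r i \<le> 1"
  using member_le_sum[of i UNIV "weight r"] weight_pos[of r] sum_weight[of r]
  by (simp add: less_imp_le)

text \<open>A positive summand of a sum equal to 1 is at most 1. Both concavity arguments draw their
  upper bound on \<open>tau\<close> from this.\<close>

lemma tau_upper: "tau r * a $ i \<le> - r $ i"
  using weight_le_1[of r i] unfolding weight_def by simp

lemma mean_a_ge: "mean_a r \<ge> a_min"
proof -
  have "a_min = (\<Sum>i\<in>UNIV. a_min * weight r i)"
    using sum_weight[of r] by (simp flip: sum_distrib_left)
  also have "\<dots> \<le> mean_a r"
    unfolding mean_a_def using a_min(2) weight_pos
    by (intro sum_mono mult_right_mono) (auto simp: less_imp_le)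
  finally show ?thesis .
qed

lemma mean_a_pos: "mean_a r > 0"
  using mean_a_ge[of r] a_min(1) by linarith

lemma tau_lipschitz: "\<bar>tau x - tau y\<bar> \<le> 1 / a_min * norm (x - y)"
proof (rule lipschitz_implicit_shift[where F = "\<lambda>x. \<Sum>i\<in>UNIV. exp (x $ i)" and c = 1 and a = a])
  show "(\<Sum>i\<in>UNIV. exp (x $ i)) < (\<Sum>i\<in>UNIV. exp (y $ i))"
    if "\<And>i. x $ i < y $ i" for x y :: "real ^ 'n"
    using that by (intro sum_strict_mono) auto
  show "(\<Sum>i\<in>UNIV. exp ((x + tau x *\<^sub>R a) $ i)) = 1" for x
    using sum_weight[of x] by (simp add: weight_def)
qed (use a_min in auto)

lemma tau_has_derivative: "(tau has_derivative tau' r) (at r)"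
proof -
  let ?F = "\<lambda>x :: real ^ 'n. \<Sum>i\<in>UNIV. exp (x $ i)"
  have "(?F has_derivative (\<lambda>h. \<Sum>i\<in>UNIV. weight r i * h $ i)) (at (r + tau r *\<^sub>R a))"
    by (auto intro!: derivative_eq_intros bounded_linear.has_derivative[OF bounded_linear_vec_nth]
        simp: weight_def mult.commute)
  moreover have "(\<Sum>i\<in>UNIV. weight r i * a $ i) = mean_a r"
    by (simp add: mean_a_def mult.commute)
  moreover have "?F (x + tau x *\<^sub>R a) = 1" for x
    using sum_weight[of x] by (simp add: weight_def)
  ultimately have "(tau has_derivative
      (\<lambda>h. - (\<Sum>i\<in>UNIV. weight r i * h $ i) / (\<Sum>i\<in>UNIV. weight r i * a $ i))) (at r)"
    using mean_a_pos[of r]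
    by (intro has_derivative_implicit_shift[where F = ?F and L = "1 / a_min" and c = 1] tau_lipschitz)
       auto
  then show ?thesis
    by (simp add: tau'_def[abs_def] mean_a_def mult.commute)
qed

lemma weighted_sum_bound: "\<bar>\<Sum>i\<in>UNIV. h $ i * weight r i\<bar> \<le> norm h"
proof -
  have "\<bar>\<Sum>i\<in>UNIV. h $ i * weight r i\<bar> \<le> (\<Sum>i\<in>UNIV. \<bar>h $ i * weight r i\<bar>)"
    by (rule sum_abs)
  also have "\<dots> \<le> (\<Sum>i\<in>UNIV. norm h * weight r i)"
    unfolding abs_mult using weight_pos component_le_norm_cart[of h]
    by (intro sum_mono mult_mono) (auto simp: less_imp_le abs_of_pos)
  also have "\<dots> = norm h" using sum_weight[of r] by (simp flip: sum_distrib_left)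
  finally show ?thesis .
qed

lemma tau'_bound: "\<bar>tau' r h\<bar> \<le> 1 / a_min * norm h"
proof -
  have "\<bar>tau' r h\<bar> = \<bar>\<Sum>i\<in>UNIV. h $ i * weight r i\<bar> / mean_a r"
    using mean_a_pos[of r] by (simp add: tau'_def)
  also have "\<dots> \<le> norm h / a_min"
    using weighted_sum_bound[of h r] mean_a_ge[of r] a_min(1) by (intro frac_le) auto
  finally show ?thesis by simp
qed

lemma bounded_C1_weight: "bounded_C1 (\<lambda>r. weight r i) (weight' i)"
proof (rule bounded_C1I[where C = 1 and C' = "1 + a $ i * (1 / a_min)"])
  show "((\<lambda>r. weight r i) has_derivative weight' i r) (at r)" for r
    unfolding weight_def weight'_def[abs_def]
    by (auto intro!: derivative_eq_intros bounded_linear.has_derivative[OF bounded_linear_vec_nth]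
        tau_has_derivative simp: algebra_simps)
  show "\<bar>weight r i\<bar> \<le> 1" for r using weight_pos[of r i] weight_le_1[of r i] by simp
  show "\<bar>weight' i r h\<bar> \<le> (1 + a $ i * (1 / a_min)) * norm h" for r h
  proof -
    have "\<bar>weight' i r h\<bar> = weight r i * \<bar>h $ i + a $ i * tau' r h\<bar>"
      using weight_pos[of r i] by (simp add: weight'_def abs_mult)
    also have "\<dots> \<le> \<bar>h $ i + a $ i * tau' r h\<bar>"
      using weight_le_1[of r i] mult_right_mono[of "weight r i" 1] by simp
    also have "\<dots> \<le> \<bar>h $ i\<bar> + a $ i * \<bar>tau' r h\<bar>"
      using a_pos[of i] abs_triangle_ineq[of "h $ i" "a $ i * tau' r h"]
      by (simp add: abs_mult)
    also have "\<dots> \<le> norm h + a $ i * (1 / a_min * norm h)"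
      using component_le_norm_cart[of h i] tau'_bound[of r h] a_pos[of i]
      by (intro add_mono mult_left_mono) auto
    finally show ?thesis by (simp add: algebra_simps)
  qed
qed

lemma bounded_C1_mean_a: "bounded_C1 mean_a (\<lambda>r h. \<Sum>i\<in>UNIV. a $ i * weight' i r h)"
proof -
  have "bounded_C1 (\<lambda>r. a $ i * weight r i) (\<lambda>r h. a $ i * weight' i r h)" for i
    using bounded_C1_mult[OF bounded_C1_const[of "a $ i"] bounded_C1_weight[of i]] by simp
  then show ?thesis
    unfolding mean_a_def[abs_def] by (intro bounded_C1_sum) auto
qed

text \<open>\<open>tau\<close> itself is unbounded, but a bounded function with bounded derivative
  composed with it stays in the class, since \<open>tau'\<close> is bounded.\<close>

lemma bounded_C1_comp_tau:
  assumes "\<And>t. (f has_real_derivative f' t) (at t)" "\<And>t. \<bar>f t\<bar> \<le> C" "\<And>t. \<bar>f' t\<bar> \<le> C'"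
  shows "bounded_C1 (\<lambda>r. f (tau r)) (\<lambda>r h. f' (tau r) * tau' r h)"
proof (rule bounded_C1I[where C = C and C' = "C' * (1 / a_min)"])
  show "((\<lambda>r. f (tau r)) has_derivative (\<lambda>h. f' (tau r) * tau' r h)) (at r)" for r
    using has_derivative_compose[OF tau_has_derivative[of r], of f "(*) (f' (tau r))"]
      assms(1)[of "tau r"] by (simp add: has_field_derivative_def)
  show "\<bar>f' (tau r) * tau' r h\<bar> \<le> C' * (1 / a_min) * norm h" for r h
    using mult_mono'[OF assms(3)[of "tau r"] tau'_bound[of r h]] by (simp add: abs_mult mult.assoc)
qed (rule assms)

end

section \<open>The normal distribution function\<close>

lemma normal_density_precision:
  assumes "\<beta> > 0"
  shows "normal_density s (1 / sqrt \<beta>) t = sqrt (\<beta> / (2 * pi)) * exp (- (\<beta> * (t - s)\<^sup>2 / 2))"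
  using assms by (simp add: normal_density_def power_divide real_sqrt_divide)

lemma has_real_derivative_normal_density:
  assumes "\<beta> > 0"
  shows "(normal_density s (1 / sqrt \<beta>) has_real_derivative
      - \<beta> * (t - s) * normal_density s (1 / sqrt \<beta>) t) (at t)"
  unfolding normal_density_precision[OF assms, abs_def]
  by (auto intro!: derivative_eq_intros)


lemma normal_density_derivative_bound:
  assumes \<beta>: "\<beta> > 0"
  shows "\<bar>- \<beta> * (t - s) * normal_density s (1 / sqrt \<beta>) t\<bar> \<le> (\<beta> + 2) * sqrt (\<beta> / (2 * pi))"
proof -
  define x where "x = t - s"
  have "0 \<le> (\<bar>x\<bar> - 1)\<^sup>2" "0 \<le> x\<^sup>2" by simp_all
  then have "\<bar>x\<bar> \<le> 1 + x\<^sup>2" by (simp add: power2_diff)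
  then have "\<beta> * \<bar>x\<bar> \<le> \<beta> * (1 + x\<^sup>2)" using \<beta> by simp
  \<comment> \<open>The factor \<open>\<beta> + 2\<close> covers both the constant and the quadratic
    term, so that \<open>1 + y \<le> exp y\<close> can then absorb the polynomial.\<close>
  also have "\<dots> \<le> (\<beta> + 2) * (1 + \<beta> * x\<^sup>2 / 2)"
  proof -
    have "0 \<le> \<beta> * (\<beta> * x\<^sup>2)" using \<beta> by simp
    moreover have "(\<beta> + 2) * (1 + \<beta> * x\<^sup>2 / 2) = \<beta> * (1 + x\<^sup>2) + 2 + \<beta> * (\<beta> * x\<^sup>2) / 2"
      by (simp add: field_simps)
    ultimately show ?thesis by linarith
  qed
  also have "\<dots> \<le> (\<beta> + 2) * exp (\<beta> * x\<^sup>2 / 2)"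
    using \<beta> by (intro mult_left_mono exp_ge_add_one_self) auto
  finally have "\<beta> * \<bar>x\<bar> * exp (- (\<beta> * x\<^sup>2 / 2)) \<le> \<beta> + 2"
    by (simp add: exp_minus field_simps)
  then have "\<beta> * \<bar>x\<bar> * exp (- (\<beta> * x\<^sup>2 / 2)) * sqrt (\<beta> / (2 * pi)) \<le> (\<beta> + 2) * sqrt (\<beta> / (2 * pi))"
    using \<beta> by (intro mult_right_mono) auto
  then show ?thesis using \<beta>
    by (simp add: normal_density_precision abs_mult x_def ac_simps)
qed

lemma normal_density_le:
  assumes "\<beta> > 0"
  shows "normal_density s (1 / sqrt \<beta>) t \<le> sqrt (\<beta> / (2 * pi))"
  unfolding normal_density_precision[OF assms] using assms by (intro mult_left_le) auto

definition normal_cdf :: "real \<Rightarrow> real \<Rightarrow> real \<Rightarrow> real" where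
  "normal_cdf s \<sigma> x = (\<integral>t\<in>{..x}. normal_density s \<sigma> t \<partial>lborel)"

lemma normal_cdf_has_real_derivative:
  assumes "\<sigma> > 0"
  shows "(normal_cdf s \<sigma> has_real_derivative normal_density s \<sigma> x) (at x)"
proof -
  let ?f = "normal_density s \<sigma>"
  have cont: "continuous_on A ?f" for A
    unfolding normal_density_def[abs_def] using assms by (intro continuous_intros) auto
  have int: "set_integrable lborel A ?f" if "A \<in> sets borel" for A
    using that assms unfolding set_integrable_def by (intro integrable_mult_indicator) auto
  \<comment> \<open>Splitting off the fixed tail up to \<open>x - 1\<close> leaves an integral with
    a finite lower limit, to which the fundamental theorem of calculus applies.\<close>
  have eq: "normal_cdf s \<sigma> y = normal_cdf s \<sigma> (x - 1) + integral {x - 1..y} ?f"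
    if "y \<in> {x - 1<..<x + 1}" for y
  proof -
    have "{..y} = {..x - 1} \<union> {x - 1<..y}" using that by auto
    then have "normal_cdf s \<sigma> y = normal_cdf s \<sigma> (x - 1) + (LINT t:{x - 1<..y}|lborel. ?f t)"
      unfolding normal_cdf_def using int by (subst set_integral_Un[symmetric]) auto
    also have "(LINT t:{x - 1<..y}|lborel. ?f t) = integral {x - 1<..y} ?f"
      by (rule set_borel_integral_eq_integral(2)[OF int]) auto
    also have "\<dots> = integral {x - 1..y} ?f"
      by (rule integral_spike_set) (auto intro: negligible_subset[of "{x - 1}"])
    finally show ?thesis .
  qed
  have "((\<lambda>y. integral {x - 1..y} ?f) has_real_derivative ?f x) (at x within {x - 1..x + 1})"
    by (rule integral_has_real_derivative[OF cont]) auto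
  then have "((\<lambda>y. integral {x - 1..y} ?f) has_real_derivative ?f x) (at x)"
    by (simp add: at_within_Icc_at)
  then have "((\<lambda>y. normal_cdf s \<sigma> (x - 1) + integral {x - 1..y} ?f) has_real_derivative ?f x) (at x)"
    by (auto intro!: derivative_eq_intros)
  then show ?thesis
    by (rule has_field_derivative_transform_within_open[of _ _ _ "{x - 1<..<x + 1}"]) (auto simp: eq)
qed

lemma normal_cdf_bounds: "0 \<le> normal_cdf s \<sigma> x" "\<sigma> > 0 \<Longrightarrow> normal_cdf s \<sigma> x \<le> 1"
proof -
  show "0 \<le> normal_cdf s \<sigma> x"
    unfolding normal_cdf_def set_lebesgue_integral_def by (intro integral_nonneg_AE) auto
  assume \<sigma>: "\<sigma> > 0"
  have "normal_cdf s \<sigma> x \<le> (\<integral>t. normal_density s \<sigma> t \<partial>lborel)"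
    unfolding normal_cdf_def set_lebesgue_integral_def
    by (intro integral_mono integrable_mult_indicator) (use \<sigma> in \<open>auto simp: indicator_def\<close>)
  also have "\<dots> = 1" using \<sigma> by simp
  finally show "normal_cdf s \<sigma> x \<le> 1" .
qed

lemma nn_integral_normal_density_le:
  assumes "\<sigma> > 0"
  shows "(\<integral>\<^sup>+t. indicator {..x} t * ennreal (normal_density s \<sigma> t) \<partial>lborel) = normal_cdf s \<sigma> x"
proof -
  have "integrable lborel (\<lambda>t. indicator {..x} t *\<^sub>R normal_density s \<sigma> t)"
    using assms by (intro integrable_mult_indicator) auto
  then have "(\<integral>\<^sup>+t. ennreal (indicator {..x} t *\<^sub>R normal_density s \<sigma> t) \<partial>lborel) = normal_cdf s \<sigma> x"
    unfolding normal_cdf_def set_lebesgue_integral_def by (rule nn_integral_eq_integral) auto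
  moreover have "ennreal (indicator {..x} t *\<^sub>R normal_density s \<sigma> t)
      = indicator {..x} t * ennreal (normal_density s \<sigma> t)" for t
    by (auto simp: indicator_def)
  ultimately show ?thesis by simp
qed

section \<open>Mixtures of normal distribution functions\<close>

lemma (in prob_space) integral_pos:
  fixes f :: "'a \<Rightarrow> real"
  assumes "integrable M f" "\<And>x. f x > 0"
  shows "(\<integral>x. f x \<partial>M) > 0"
proof -
  have "(\<integral>x. f x \<partial>M) \<noteq> 0"
  proof
    assume "(\<integral>x. f x \<partial>M) = 0"
    then have "AE x in M. f x = 0"
      using assms by (subst (asm) integral_nonneg_eq_0_iff_AE) (auto simp: less_imp_le)
    then have "AE x in M. False"
      by eventually_elim (use assms(2) in \<open>metis less_irrefl\<close>)
    then show False by simp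
  qed
  moreover have "(\<integral>x. f x \<partial>M) \<ge> 0"
    using assms by (intro integral_nonneg_AE) (auto simp: less_imp_le)
  ultimately show ?thesis by simp
qed

locale normal_level = positive_direction a for a :: "real ^ 'n" +
  fixes \<beta> s :: real
  assumes \<beta>_pos: "\<beta> > 0"
begin

definition phi :: "real \<Rightarrow> real" where "phi = normal_density s (1 / sqrt \<beta>)"

text \<open>Minus the partial derivative in coordinate \<open>i\<close> of the normal distribution
  function at \<open>tau r\<close>.\<close>

definition dens :: "'n \<Rightarrow> real ^ 'n \<Rightarrow> real" where
  "dens i r = phi (tau r) * weight r i * inverse (mean_a r)"

text \<open>Kept in the raw shape that the product and reciprocal rules for
  \<open>bounded_C1\<close> produce; \<open>dens_second_order\<close> simplifies it.\<close>

definition dens' :: "'n \<Rightarrow> real ^ 'n \<Rightarrow> real ^ 'n \<Rightarrow> real" where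
  "dens' i r h = phi (tau r) * weight r i *
       - (inverse (mean_a r) * (\<Sum>j\<in>UNIV. a $ j * weight' j r h) * inverse (mean_a r)) +
     (phi (tau r) * weight' i r h + - \<beta> * (tau r - s) * phi (tau r) * tau' r h * weight r i) *
       inverse (mean_a r)"

lemma phi_pos: "phi t > 0"
  unfolding phi_def using \<beta>_pos by (intro normal_density_pos) auto

lemma dens_pos: "dens i r > 0"
  unfolding dens_def using phi_pos weight_pos mean_a_pos by simp

lemma bounded_C1_phi_tau:
  "bounded_C1 (\<lambda>r. phi (tau r)) (\<lambda>r h. - \<beta> * (tau r - s) * phi (tau r) * tau' r h)"
  unfolding phi_def using \<beta>_pos
  by (intro bounded_C1_comp_tau[where C = "sqrt (\<beta> / (2 * pi))"
        and C' = "(\<beta> + 2) * sqrt (\<beta> / (2 * pi))"] has_real_derivative_normal_density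
      normal_density_derivative_bound) (simp_all add: normal_density_le)

lemma bounded_C1_dens: "bounded_C1 (dens i) (dens' i)"
  unfolding dens_def[abs_def] dens'_def[abs_def]
  by (intro bounded_C1_mult bounded_C1_inverse[where \<kappa> = a_min] bounded_C1_mean_a
      bounded_C1_phi_tau bounded_C1_weight a_min(1) mean_a_ge)

lemma bounded_C1_normal_cdf_tau:
  "bounded_C1 (\<lambda>r. normal_cdf s (1 / sqrt \<beta>) (tau r)) (\<lambda>r h. - (\<Sum>i\<in>UNIV. h $ i * dens i r))"
proof -
  have "bounded_C1 (\<lambda>r. normal_cdf s (1 / sqrt \<beta>) (tau r)) (\<lambda>r h. phi (tau r) * tau' r h)"
    using \<beta>_pos unfolding phi_def
    by (intro bounded_C1_comp_tau[where C = 1 and C' = "sqrt (\<beta> / (2 * pi))"]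
        normal_cdf_has_real_derivative) (auto simp: normal_cdf_bounds normal_density_le)
  moreover have "phi (tau r) * tau' r h = - (\<Sum>i\<in>UNIV. h $ i * dens i r)" for r h
    by (simp add: tau'_def dens_def divide_inverse sum_distrib_left sum_distrib_right ac_simps)
  ultimately show ?thesis by simp
qed

text \<open>This is the integrand of the Hessian form. After substituting
  \<open>tau' r \<delta> = - P r / mean_a r\<close>, the squares of \<delta> produced by
  \<open>weight'\<close> cancel the subtracted sum, leaving a multiple of the square of
  \<open>P r\<close> and one mixed term.\<close>

lemma dens_second_order:
  fixes \<delta> :: "real ^ 'n"
  defines "P \<equiv> \<lambda>r. \<Sum>i\<in>UNIV. \<delta> $ i * weight r i"
    and "S \<equiv> \<lambda>r. \<Sum>i\<in>UNIV. a $ i * \<delta> $ i * weight r i"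
    and "E \<equiv> \<lambda>r. \<Sum>i\<in>UNIV. (a $ i)\<^sup>2 * weight r i"
  shows "(\<Sum>i\<in>UNIV. \<delta> $ i * dens' i r \<delta>) - (\<Sum>i\<in>UNIV. (\<delta> $ i)\<^sup>2 * dens i r)
    = phi (tau r) * ((\<beta> * (tau r - s) + E r / mean_a r) * (P r / mean_a r)\<^sup>2
        - 2 * S r * P r / (mean_a r)\<^sup>2)"
proof -
  let ?t = "tau' r \<delta>" and ?D = "mean_a r" and ?f = "phi (tau r)"
  define V where "V = (\<Sum>i\<in>UNIV. (\<delta> $ i)\<^sup>2 * weight r i)"
  have D: "?D \<noteq> 0" using mean_a_pos[of r] by simp
  have t: "?t = - P r / ?D" by (simp add: tau'_def P_def)
  have w': "(\<Sum>i\<in>UNIV. \<delta> $ i * weight' i r \<delta>) = V + S r * ?t"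
    by (simp add: weight'_def V_def S_def algebra_simps sum.distrib sum_distrib_left power2_eq_square)
  have a': "(\<Sum>i\<in>UNIV. a $ i * weight' i r \<delta>) = S r + E r * ?t"
    by (simp add: weight'_def E_def S_def algebra_simps sum.distrib sum_distrib_left power2_eq_square)
  have "(\<Sum>i\<in>UNIV. \<delta> $ i * dens' i r \<delta>) =
      (\<Sum>i\<in>UNIV. - ?f * (S r + E r * ?t) / ?D\<^sup>2 * (\<delta> $ i * weight r i)
        + ?f / ?D * (\<delta> $ i * weight' i r \<delta>)
        + - \<beta> * (tau r - s) * ?f * ?t / ?D * (\<delta> $ i * weight r i))"
    unfolding dens'_def a' by (intro sum.cong refl) (simp add: divide_simps D power2_eq_square algebra_simps)
  also have "\<dots> = - ?f * (S r + E r * ?t) / ?D\<^sup>2 * P r + ?f / ?D * (V + S r * ?t)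
        + - \<beta> * (tau r - s) * ?f * ?t / ?D * P r"
    unfolding P_def w'[symmetric] by (simp only: sum.distrib sum_distrib_left)
  finally have 1: "(\<Sum>i\<in>UNIV. \<delta> $ i * dens' i r \<delta>) = \<dots>" .
  have 2: "(\<Sum>i\<in>UNIV. (\<delta> $ i)\<^sup>2 * dens i r) = ?f / ?D * V"
    by (simp add: dens_def V_def sum_distrib_left divide_inverse ac_simps)
  show ?thesis
    unfolding 1 2 t using D by (simp add: field_simps power2_eq_square)
qed

end

locale normal_mixture = normal_level a \<beta> s + prob_space N
  for a :: "real ^ 'n" and \<beta> s and N :: "'b measure" +
  fixes R :: "'b \<Rightarrow> real ^ 'n"
  assumes R_measurable[measurable]: "R \<in> borel_measurable N"
begin

text \<open>In the application \<open>R\<close> is the residual of the Gaussian vector, and the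
  integrand is the conditional probability of the event given that residual.\<close>

definition mix_cdf :: "real ^ 'n \<Rightarrow> real" where
  "mix_cdf l = (\<integral>z. normal_cdf s (1 / sqrt \<beta>) (tau (l + R z)) \<partial>N)"

text \<open>Minus the partial derivative of \<open>mix_cdf\<close> in coordinate
  \<open>i\<close>.\<close>

definition mix_dens :: "'n \<Rightarrow> real ^ 'n \<Rightarrow> real" where
  "mix_dens i l = (\<integral>z. dens i (l + R z) \<partial>N)"

definition mix_dens' :: "'n \<Rightarrow> real ^ 'n \<Rightarrow> real ^ 'n \<Rightarrow> real" where
  "mix_dens' i l h = (\<integral>z. dens' i (l + R z) h \<partial>N)"

lemmas integrable_dens [simp] =
  has_derivative_integral_translate(2)[OF prob_space_axioms R_measurable bounded_C1_dens]
lemmas integrable_dens' [simp] =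
  has_derivative_integral_translate(3)[OF prob_space_axioms R_measurable bounded_C1_dens]

lemma mix_dens_has_derivative: "(mix_dens i has_derivative mix_dens' i l) (at l)"
  unfolding mix_dens_def[abs_def] mix_dens'_def[abs_def]
  by (rule has_derivative_integral_translate(1)[OF prob_space_axioms R_measurable bounded_C1_dens])

lemma mix_cdf_has_derivative:
  "(mix_cdf has_derivative (\<lambda>h. - (\<Sum>i\<in>UNIV. h $ i * mix_dens i l))) (at l)"
proof -
  have "(mix_cdf has_derivative (\<lambda>h. \<integral>z. - (\<Sum>i\<in>UNIV. h $ i * dens i (l + R z)) \<partial>N)) (at l)"
    unfolding mix_cdf_def[abs_def]
    by (rule has_derivative_integral_translate(1)[OF prob_space_axioms R_measurable
          bounded_C1_normal_cdf_tau])
  then show ?thesis by (simp add: mix_dens_def)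
qed

lemma mix_dens_pos: "mix_dens i l > 0"
  unfolding mix_dens_def by (intro integral_pos dens_pos) simp

lemma mix_dens_second_order:
  "(\<Sum>i\<in>UNIV. \<delta> $ i * mix_dens' i l \<delta>) - (\<Sum>i\<in>UNIV. (\<delta> $ i)\<^sup>2 * mix_dens i l)
    = (\<integral>z. (\<Sum>i\<in>UNIV. \<delta> $ i * dens' i (l + R z) \<delta>) - (\<Sum>i\<in>UNIV. (\<delta> $ i)\<^sup>2 * dens i (l + R z)) \<partial>N)"
  by (simp add: mix_dens'_def mix_dens_def)

text \<open>Along the segment from \<open>x\<close> to \<open>y\<close> the derivative is minus a
  combination of the positive \<open>mix_dens\<close> with positive coefficients.\<close>

lemma mix_cdf_strict_antimono:
  assumes "\<And>i. x $ i < y $ i"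
  shows "mix_cdf y < mix_cdf x"
proof -
  define h where "h = (\<lambda>t. mix_cdf (x + t *\<^sub>R (y - x)))"
  have "\<exists>D. DERIV h t :> D \<and> D < 0" for t
  proof -
    let ?D = "- (\<Sum>i\<in>UNIV. (y - x) $ i * mix_dens i (x + t *\<^sub>R (y - x)))"
    have "(h has_derivative (\<lambda>u. - (\<Sum>i\<in>UNIV. (u *\<^sub>R (y - x)) $ i * mix_dens i (x + t *\<^sub>R (y - x))))) (at t)"
      unfolding h_def
      by (rule has_derivative_compose[OF _ mix_cdf_has_derivative]) (auto intro!: derivative_eq_intros)
    moreover have "(\<lambda>u. - (\<Sum>i\<in>UNIV. (u *\<^sub>R (y - x)) $ i * mix_dens i (x + t *\<^sub>R (y - x)))) = (*) ?D"
      by (auto simp: sum_distrib_left sum_distrib_right fun_eq_iff algebra_simps)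
    ultimately have "DERIV h t :> ?D" by (simp add: has_field_derivative_def)
    moreover have "?D < 0"
      using assms mix_dens_pos by (auto intro!: sum_pos)
    ultimately show ?thesis by blast
  qed
  then have "h 1 < h 0" by (intro DERIV_neg_imp_decreasing[of 0 1]) auto
  then show ?thesis by (simp add: h_def)
qed

lemma mix_cdf_nonneg: "mix_cdf l \<ge> 0"
  unfolding mix_cdf_def by (intro integral_nonneg_AE) (auto simp: normal_cdf_bounds)

end

section \<open>Hessian of a level function\<close>

lemma open_positive_orthant: "open {w :: real ^ 'n. \<forall>i. w $ i > 0}"
proof -
  have "{w :: real ^ 'n. \<forall>i. w $ i > 0} = (\<Inter>i. {w. 0 < w $ i})" by auto
  then show ?thesis by (auto intro!: open_INT open_Collect_less continuous_intros)
qed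

context normal_mixture
begin

definition log_point :: "(real ^ 'n \<Rightarrow> real) \<Rightarrow> real ^ 'n \<Rightarrow> real ^ 'n" where
  "log_point q u = (\<chi> i. ln (u $ i) - ln (q u))"

text \<open>At \<open>log_point q u\<close> these are the elasticities of \<open>q\<close>:
  \<open>u $ i\<close> times the partial derivative, divided by \<open>q u\<close>. They sum to
  1.\<close>

definition share :: "'n \<Rightarrow> real ^ 'n \<Rightarrow> real" where
  "share i l = mix_dens i l / (\<Sum>j\<in>UNIV. mix_dens j l)"

definition level_deriv :: "(real ^ 'n \<Rightarrow> real) \<Rightarrow> real ^ 'n \<Rightarrow> real ^ 'n \<Rightarrow> real" where
  "level_deriv q u h = q u * (\<Sum>i\<in>UNIV. h $ i / u $ i * share i (log_point q u))"

text \<open>The velocity of \<open>log_point q\<close> when \<open>u\<close> moves with velocity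
  \<open>v\<close>: the entries \<open>v $ i / u $ i\<close> centred at their mean under
  \<open>share\<close>. It vanishes on multiples of \<open>u\<close>.\<close>

definition tangent :: "(real ^ 'n \<Rightarrow> real) \<Rightarrow> real ^ 'n \<Rightarrow> real ^ 'n \<Rightarrow> real ^ 'n" where
  "tangent q u v = (\<chi> i. v $ i / u $ i - level_deriv q u v / q u)"

lemma mix_dens_sum_pos: "(\<Sum>j\<in>UNIV. mix_dens j l) > 0"
  by (intro sum_pos mix_dens_pos) auto

context
  fixes q :: "real ^ 'n \<Rightarrow> real" and \<alpha> :: real
  assumes q_pos: "\<And>u. (\<And>i. u $ i > 0) \<Longrightarrow> q u > 0"
    and q_level: "\<And>u. (\<And>i. u $ i > 0) \<Longrightarrow> mix_cdf (\<chi> i. ln (u $ i) - ln (q u)) = \<alpha>"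
begin

text \<open>In logarithmic coordinates the level equation makes \<open>T\<close>, the logarithm of
  \<open>q\<close>, an implicit shift of \<open>mix_cdf\<close> in direction \<open>- 1\<close>; the
  chain rule then returns to \<open>q\<close>.\<close>

lemma level_has_derivative:
  assumes u: "\<And>i. u $ i > 0"
  shows "(q has_derivative level_deriv q u) (at u)"
proof -
  define T where "T = (\<lambda>l::real^'n. ln (q (\<chi> i. exp (l $ i))))"
  have T_level: "mix_cdf (l + T l *\<^sub>R (- 1)) = \<alpha>" for l
  proof -
    have "l + T l *\<^sub>R (- 1) = (\<chi> i. ln ((\<chi> i. exp (l $ i)) $ i) - ln (q (\<chi> i. exp (l $ i))))"
      by (simp add: vec_eq_iff T_def)
    also have "mix_cdf \<dots> = \<alpha>" by (rule q_level) simp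
    finally show ?thesis .
  qed
  have lip: "\<bar>T x - T y\<bar> \<le> 1 / 1 * norm (x - y)" for x y
  proof -
    \<comment> \<open>The Lipschitz lemma asks for an increasing function and a positive direction,
      so the decreasing \<open>mix_cdf\<close> is composed with negation.\<close>
    have "\<bar>T (- (- x)) - T (- (- y))\<bar> \<le> 1 / 1 * norm (- x - - y)"
    proof (rule lipschitz_implicit_shift[where F = "\<lambda>x. mix_cdf (- x)" and c = \<alpha> and a = 1])
      show "mix_cdf (- (x + T (- x) *\<^sub>R 1)) = \<alpha>" for x
        using T_level[of "- x"] by simp
      show "mix_cdf (- x) < mix_cdf (- y)" if "\<And>i. x $ i < y $ i" for x y
        using that by (intro mix_cdf_strict_antimono) simp
    qed auto
    then show ?thesis by (simp add: norm_minus_commute)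
  qed
  define l where "l = (\<chi> i. ln (u $ i))"
  have q_eq: "q w = exp (T (\<chi> i. ln (w $ i)))" if "\<And>i. w $ i > 0" for w
    using q_pos[of w] that by (simp add: T_def vec_lambda_eta)
  have lp: "l + T l *\<^sub>R (- 1) = log_point q u"
    using u by (simp add: l_def log_point_def T_def vec_eq_iff vec_lambda_eta)
  have "(T has_derivative (\<lambda>h. - (- (\<Sum>i\<in>UNIV. h $ i * mix_dens i (l + T l *\<^sub>R (- 1))))
      / - (\<Sum>i\<in>UNIV. (- 1 :: real ^ 'n) $ i * mix_dens i (l + T l *\<^sub>R (- 1))))) (at l)"
    by (rule has_derivative_implicit_shift[OF mix_cdf_has_derivative _ lip T_level])
       (use mix_dens_sum_pos[of "l + T l *\<^sub>R (- 1)"] in \<open>simp add: sum_negf\<close>)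
  then have T': "(T has_derivative (\<lambda>h. \<Sum>i\<in>UNIV. h $ i * share i (log_point q u))) (at l)"
    unfolding lp by (simp add: share_def sum_negf sum_divide_distrib)
  have ln': "((\<lambda>w. \<chi> i. ln (w $ i)) has_derivative (\<lambda>h. \<chi> i. h $ i / u $ i)) (at u)"
  proof (rule has_derivative_componentwise_within[THEN iffD2], rule ballI)
    fix b :: "real ^ 'n" assume "b \<in> Basis"
    then obtain i where b: "b = axis i 1" by (auto simp: Basis_vec_def)
    have "((\<lambda>w. ln (w $ i)) has_derivative (\<lambda>h. h $ i / u $ i)) (at u)"
      using u[of i] by (auto intro!: derivative_eq_intros
          bounded_linear.has_derivative[OF bounded_linear_vec_nth] simp: divide_inverse)
    then show "((\<lambda>w. (\<chi> i. ln (w $ i)) \<bullet> b) has_derivative (\<lambda>h. (\<chi> i. h $ i / u $ i) \<bullet> b)) (at u)"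
      by (simp add: b inner_axis)
  qed
  have "((\<lambda>w. T (\<chi> i. ln (w $ i))) has_derivative
      (\<lambda>h. \<Sum>i\<in>UNIV. (\<chi> i. h $ i / u $ i) $ i * share i (log_point q u))) (at u)"
    by (rule has_derivative_compose[OF ln' T'[unfolded l_def]])
  then have "((\<lambda>w. exp (T (\<chi> i. ln (w $ i)))) has_derivative level_deriv q u) (at u)"
    by (auto intro!: derivative_eq_intros simp: level_deriv_def fun_eq_iff q_eq[OF u])
  then show ?thesis
    by (rule has_derivative_transform_within_open[OF _ open_positive_orthant]) (use u q_eq in auto)
qed

lemma log_point_has_derivative:
  assumes u: "\<And>i. u $ i > 0"
  shows "(log_point q has_derivative (\<lambda>h. \<chi> i. h $ i / u $ i - level_deriv q u h / q u)) (at u)"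
proof (rule has_derivative_componentwise_within[THEN iffD2], rule ballI)
  fix b :: "real ^ 'n" assume "b \<in> Basis"
  then obtain i where b: "b = axis i 1" by (auto simp: Basis_vec_def)
  have "((\<lambda>w. ln (w $ i) - ln (q w)) has_derivative (\<lambda>h. h $ i / u $ i - level_deriv q u h / q u)) (at u)"
    using u[of i] q_pos[of u] u by (auto intro!: derivative_eq_intros level_has_derivative
        bounded_linear.has_derivative[OF bounded_linear_vec_nth] simp: divide_inverse)
  then show "((\<lambda>w. log_point q w \<bullet> b) has_derivative (\<lambda>h. (\<chi> i. h $ i / u $ i - level_deriv q u h / q u) \<bullet> b)) (at u)"
    by (simp add: b inner_axis log_point_def)
qed

text \<open>The log point moves within a level set of \<open>mix_cdf\<close>, whose gradient has the
  entries \<open>- mix_dens i\<close>.\<close>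

lemma tangent_orthogonal:
  assumes u: "\<And>i. u $ i > 0"
  shows "(\<Sum>i\<in>UNIV. tangent q u v $ i * mix_dens i (log_point q u)) = 0"
proof -
  let ?n = "\<lambda>i. mix_dens i (log_point q u)"
  have "level_deriv q u v / q u * (\<Sum>i\<in>UNIV. ?n i) = (\<Sum>i\<in>UNIV. v $ i / u $ i * ?n i)"
  proof -
    have "level_deriv q u v / q u = (\<Sum>i\<in>UNIV. v $ i / u $ i * ?n i) / (\<Sum>i\<in>UNIV. ?n i)"
      using q_pos[of u] u by (simp add: level_deriv_def share_def sum_divide_distrib)
    then show ?thesis using mix_dens_sum_pos[of "log_point q u"] by simp
  qed
  then show ?thesis
    by (simp add: tangent_def left_diff_distrib sum_subtractf sum_distrib_left)
qed

text \<open>The gradient has the entries \<open>q u * share i l / u $ i\<close>. Differentiating it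
  and centring \<open>v $ i / u $ i\<close> at its mean turns the quadratic form into one in the
  tangent vector; the subtracted squares stem from the logarithmic coordinates.\<close>

lemma level_hessian:
  assumes u: "\<And>i. u $ i > 0"
  defines "l \<equiv> log_point q u"
  shows "\<exists>H. has_hessian q H u \<and> (\<forall>v. v \<bullet> (H *v v) =
    q u / (\<Sum>i\<in>UNIV. mix_dens i l) *
      ((\<Sum>i\<in>UNIV. tangent q u v $ i * mix_dens' i l (tangent q u v))
       - (\<Sum>i\<in>UNIV. (tangent q u v $ i)\<^sup>2 * mix_dens i l)))"
proof -
  define f where "f = (\<lambda>i w. q w * share i (log_point q w) / w $ i)"
  define g where "g = (\<lambda>w. \<Sum>i\<in>UNIV. f i w *\<^sub>R axis i (1::real))"
  define N where "N = (\<Sum>i\<in>UNIV. mix_dens i l)"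
  define n where "n = (\<lambda>i. mix_dens i l)"
  define n' where "n' = (\<lambda>v i. mix_dens' i l (tangent q u v))"
  define N' where "N' = (\<lambda>v. \<Sum>i\<in>UNIV. n' v i)"
  define f' where "f' = (\<lambda>i v. (level_deriv q u v * n i / N + q u * (n' v i / N - n i * N' v / N\<^sup>2)
      - q u * n i / N * (v $ i / u $ i)) / u $ i)"
  define g' where "g' = (\<lambda>v. \<Sum>i\<in>UNIV. f' i v *\<^sub>R axis i (1::real))"
  have N: "N > 0" unfolding N_def by (rule mix_dens_sum_pos)
  have qu: "q u > 0" using q_pos u by blast
  have grad: "GDERIV q w :> g w" if w: "\<And>i. w $ i > 0" for w
  proof -
    have "(\<lambda>h. h \<bullet> g w) = level_deriv q w"
      by (auto simp: g_def f_def level_deriv_def inner_sum_right inner_axis sum_distrib_left fun_eq_iff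
          intro!: sum.cong)
    then show ?thesis using level_has_derivative[OF w] by (simp add: gderiv_def)
  qed
  have n_deriv: "((\<lambda>w. mix_dens i (log_point q w)) has_derivative (\<lambda>v. n' v i)) (at u)" for i
    using has_derivative_compose[OF log_point_has_derivative[OF u] mix_dens_has_derivative]
    by (simp add: n'_def l_def tangent_def)
  have N_deriv: "((\<lambda>w. \<Sum>j\<in>UNIV. mix_dens j (log_point q w)) has_derivative N') (at u)"
    unfolding N'_def by (intro has_derivative_sum n_deriv)
  have f_deriv: "(f i has_derivative f' i) (at u)" for i
  proof -
    have "(f i has_derivative (\<lambda>h. ((q u * ((n' h i * N - n i * N' h) / (N * N)) + level_deriv q u h * (n i / N)) * u $ i
        - q u * (n i / N) * h $ i) / (u $ i * u $ i))) (at u)"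
      unfolding f_def share_def n_def N_def l_def
      using u[of i] mix_dens_sum_pos[of "log_point q u"]
      by (intro has_derivative_divide' has_derivative_mult level_has_derivative[OF u] n_deriv N_deriv
          bounded_linear_imp_has_derivative bounded_linear_vec_nth) auto
    also have "(\<lambda>h. ((q u * ((n' h i * N - n i * N' h) / (N * N)) + level_deriv q u h * (n i / N)) * u $ i
        - q u * (n i / N) * h $ i) / (u $ i * u $ i)) = f' i"
    proof
      fix h
      have "u $ i \<noteq> 0" "N \<noteq> 0" using u[of i] N by auto
      then show "((q u * ((n' h i * N - n i * N' h) / (N * N)) + level_deriv q u h * (n i / N)) * u $ i
        - q u * (n i / N) * h $ i) / (u $ i * u $ i) = f' i h"
        unfolding f'_def by (simp add: field_simps power2_eq_square)
    qed
    finally show ?thesis .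
  qed
  have g_deriv: "(g has_derivative g') (at u)"
    unfolding g_def g'_def by (intro has_derivative_sum has_derivative_scaleR_left f_deriv)
  then have g'_matrix: "g' = (\<lambda>v. matrix g' *v v)"
    using matrix_vector_mul(2)[OF has_derivative_linear[OF g_deriv]] by simp
  then have "(g has_derivative (\<lambda>v. matrix g' *v v)) (at u)"
    using g_deriv by simp
  moreover have "\<forall>\<^sub>F x in nhds u. GDERIV q x :> g x"
  proof -
    show ?thesis
      using u grad open_positive_orthant[where 'n = 'n] unfolding eventually_nhds by (intro exI[of _ "{w. \<forall>i. w $ i > 0}"]) auto
  qed
  ultimately have "has_hessian q (matrix g') u" unfolding has_hessian_def by blast
  moreover have "v \<bullet> (matrix g' *v v) = q u / N *
      ((\<Sum>i\<in>UNIV. tangent q u v $ i * n' v i) - (\<Sum>i\<in>UNIV. (tangent q u v $ i)\<^sup>2 * n i))" for v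
  proof -
    \<comment> \<open>\<open>\<gamma>\<close> is the velocity of the logarithms of \<open>u\<close>,
      and \<open>m\<close> is its mean under \<open>share\<close>.\<close>
    define \<gamma> where "\<gamma> = (\<lambda>i. v $ i / u $ i)"
    define m where "m = level_deriv q u v / q u"
    have lvl: "level_deriv q u v = q u * m" using qu by (simp add: m_def)
    have \<delta>: "tangent q u v $ i = \<gamma> i - m" for i by (simp add: tangent_def \<gamma>_def m_def)
    have m: "(\<Sum>i\<in>UNIV. \<gamma> i * n i) = m * N"
      using tangent_orthogonal[OF u, of v]
      by (simp add: \<delta> n_def N_def l_def left_diff_distrib sum_subtractf sum_distrib_left)
    have "v \<bullet> (matrix g' *v v) = v \<bullet> g' v" using g'_matrix by metis
    also have "\<dots> = (\<Sum>i\<in>UNIV. v $ i * f' i v)"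
      by (simp add: g'_def inner_sum_right inner_axis mult.commute)
    also have "\<dots> = (\<Sum>i\<in>UNIV. q u / N * (m - N' v / N) * (\<gamma> i * n i)
        + q u / N * (\<gamma> i * n' v i) - q u / N * ((\<gamma> i)\<^sup>2 * n i))"
      using u N unfolding f'_def lvl \<gamma>_def
      by (intro sum.cong refl) (simp add: divide_simps, simp add: algebra_simps power2_eq_square)
    also have "\<dots> = q u / N * (m - N' v / N) * (m * N)
        + q u / N * (\<Sum>i\<in>UNIV. \<gamma> i * n' v i) - q u / N * (\<Sum>i\<in>UNIV. (\<gamma> i)\<^sup>2 * n i)"
      unfolding m[symmetric] by (simp only: sum.distrib sum_subtractf sum_distrib_left)
    \<comment> \<open>The square of \<open>m\<close> completes the sum of squares to a variance, and
      \<open>m * N' v\<close> centres the linear sum.\<close>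
    also have "\<dots> = q u / N * (((\<Sum>i\<in>UNIV. \<gamma> i * n' v i) - m * N' v)
        - ((\<Sum>i\<in>UNIV. (\<gamma> i)\<^sup>2 * n i) - m\<^sup>2 * N))"
      using N by (simp add: field_simps power2_eq_square)
    also have "(\<Sum>i\<in>UNIV. \<gamma> i * n' v i) - m * N' v = (\<Sum>i\<in>UNIV. tangent q u v $ i * n' v i)"
      by (simp add: \<delta> N'_def left_diff_distrib sum_subtractf sum_distrib_left)
    also have "(\<Sum>i\<in>UNIV. (\<gamma> i)\<^sup>2 * n i) - m\<^sup>2 * N = (\<Sum>i\<in>UNIV. (tangent q u v $ i)\<^sup>2 * n i)"
    proof -
      have "(\<Sum>i\<in>UNIV. (tangent q u v $ i)\<^sup>2 * n i)
          = (\<Sum>i\<in>UNIV. (\<gamma> i)\<^sup>2 * n i - 2 * m * (\<gamma> i * n i) + m\<^sup>2 * n i)"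
        by (intro sum.cong refl) (simp add: \<delta> power2_diff algebra_simps)
      also have "\<dots> = (\<Sum>i\<in>UNIV. (\<gamma> i)\<^sup>2 * n i) - 2 * m * (m * N) + m\<^sup>2 * N"
      proof -
        have "(\<Sum>i\<in>UNIV. 2 * m * (\<gamma> i * n i)) = 2 * m * (m * N)"
          unfolding m[symmetric] by (simp only: sum_distrib_left)
        moreover have "(\<Sum>i\<in>UNIV. m\<^sup>2 * n i) = m\<^sup>2 * N"
          unfolding N_def n_def by (simp only: sum_distrib_left)
        ultimately show ?thesis by (simp only: sum.distrib sum_subtractf)
      qed
      finally show ?thesis by (simp add: power2_eq_square)
    qed
    finally show ?thesis .
  qed
  ultimately show ?thesis unfolding N_def n_def n'_def by blast
qed

end
end

section \<open>Gaussian translation identity\<close>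

lemma nn_integral_lborel_translate:
  fixes f :: "'a::euclidean_space \<Rightarrow> ennreal"
  assumes [measurable]: "f \<in> borel_measurable borel"
  shows "(\<integral>\<^sup>+z. f (z + c) \<partial>lborel) = (\<integral>\<^sup>+z. f z \<partial>lborel)"
proof -
  have "(\<integral>\<^sup>+z. f z \<partial>lborel) = (\<integral>\<^sup>+z. f z \<partial>distr lborel borel ((+) c))"
    by (simp add: lborel_distr_plus)
  also have "\<dots> = (\<integral>\<^sup>+z. f (z + c) \<partial>lborel)"
    by (subst nn_integral_distr) (auto simp: add.commute)
  finally show ?thesis by simp
qed

lemma inner_matrix_symmetric:
  fixes B :: "real ^ 'n ^ 'n"
  assumes "transpose B = B"
  shows "x \<bullet> (B *v y) = (B *v x) \<bullet> y"
  using assms by (metis dot_lmul_matrix vector_transpose_matrix)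

text \<open>Under \<open>N(\<mu>, B\<inverse>)\<close> the variables \<open>coord z\<close> and \<open>z - coord z *\<^sub>R a\<close> are independent, and
  \<open>coord z\<close> is normal with variance \<open>1 / \<beta>\<close>; averaging over translations along \<open>a\<close> proves this
  without disintegrating Lebesgue measure.\<close>
lemma gaussian_shift:
  fixes B :: "real ^ 'n ^ 'n" and F :: "real ^ 'n \<Rightarrow> ennreal" and a \<mu> :: "real ^ 'n" and c :: real
  assumes sym: "transpose B = B"
    and [measurable]: "F \<in> borel_measurable borel"
    and \<beta>_pos: "a \<bullet> (B *v a) > 0"
    and c: "c \<ge> 0"
  defines "\<beta> \<equiv> a \<bullet> (B *v a)"
  defines "coord \<equiv> \<lambda>z. ((B *v a) \<bullet> z) / \<beta>"
    and "\<rho> \<equiv> \<lambda>z. c * exp (- ((z - \<mu>) \<bullet> (B *v (z - \<mu>))) / 2)"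
  shows "(\<integral>\<^sup>+z. F z * ennreal (\<rho> z) \<partial>lborel) =
    (\<integral>\<^sup>+z. (\<integral>\<^sup>+t. F (z - coord z *\<^sub>R a + t *\<^sub>R a)
        * ennreal (normal_density (coord \<mu>) (1 / sqrt \<beta>) t) \<partial>lborel) * ennreal (\<rho> z) \<partial>lborel)"
    (is "_ = ?rhs")
proof -
  let ?\<phi> = "normal_density (coord \<mu>) (1 / sqrt \<beta>)"
  have \<beta>: "\<beta> > 0" using \<beta>_pos by (simp add: \<beta>_def)
  have coord_a: "coord (z + t *\<^sub>R a) = coord z + t" for z t
    using \<beta> by (simp add: coord_def \<beta>_def inner_right_distrib inner_commute add_divide_distrib)
  have [measurable]: "(*v) B \<in> borel_measurable borel"
    by (intro borel_measurable_continuous_onI linear_continuous_on) (rule matrix_vector_mul_bounded_linear)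
  have [measurable]: "coord \<in> borel_measurable borel" unfolding coord_def by measurable
  have [measurable]: "\<rho> \<in> borel_measurable borel" unfolding \<rho>_def by measurable
  have \<rho>_nonneg: "\<rho> z \<ge> 0" for z using c by (simp add: \<rho>_def)
  \<comment> \<open>Completing the square: the exponents regroup into the density at
    \<open>z\<close> times a normal density in \<open>t\<close>, whose integral over
    \<open>t\<close> is 1.\<close>
  have key: "?\<phi> (coord z) * \<rho> (z - t *\<^sub>R a) = \<rho> z * normal_density (coord z - coord \<mu>) (1 / sqrt \<beta>) t"
    for z t
  proof -
    define w where "w = z - \<mu>"
    define s where "s = coord z - coord \<mu>"
    have s: "(B *v a) \<bullet> w = \<beta> * s"
      using \<beta> by (simp add: s_def w_def coord_def inner_diff_right diff_divide_distrib[symmetric])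
    have "z - t *\<^sub>R a - \<mu> = w - t *\<^sub>R a" by (simp add: w_def)
    then have "(z - t *\<^sub>R a - \<mu>) \<bullet> (B *v (z - t *\<^sub>R a - \<mu>))
        = w \<bullet> (B *v w) - t * (w \<bullet> (B *v a)) - t * (a \<bullet> (B *v w)) + t * t * \<beta>"
      by (simp add: matrix_vector_mult_diff_distrib matrix_vector_mult_scaleR inner_diff_left
          inner_diff_right \<beta>_def algebra_simps)
    also have "w \<bullet> (B *v a) = \<beta> * s" using s by (simp add: inner_commute)
    also have "a \<bullet> (B *v w) = \<beta> * s" using s inner_matrix_symmetric[OF sym] by simp
    finally have q: "(z - t *\<^sub>R a - \<mu>) \<bullet> (B *v (z - t *\<^sub>R a - \<mu>))
        = w \<bullet> (B *v w) - 2 * t * \<beta> * s + t * t * \<beta>" by simp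
    have "- (\<beta> * s\<^sup>2 / 2) + - (w \<bullet> (B *v w) - 2 * t * \<beta> * s + t * t * \<beta>) / 2
        = - (w \<bullet> (B *v w)) / 2 + - (\<beta> * (t - s)\<^sup>2 / 2)"
      by (simp add: power2_eq_square field_simps)
    then have "exp (- (\<beta> * s\<^sup>2 / 2)) * exp (- (w \<bullet> (B *v w) - 2 * t * \<beta> * s + t * t * \<beta>) / 2)
        = exp (- (w \<bullet> (B *v w)) / 2) * exp (- (\<beta> * (t - s)\<^sup>2 / 2))"
      by (simp only: exp_add[symmetric])
    then show ?thesis
      unfolding normal_density_precision[OF \<beta>] \<rho>_def q s_def[symmetric] w_def[symmetric]
      by (simp add: mult.assoc mult.left_commute)
  qed
  have mass: "(\<integral>\<^sup>+t. ennreal (normal_density m (1 / sqrt \<beta>) t) \<partial>lborel) = 1" for m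
    using \<beta> by (subst nn_integral_eq_integral) auto
  \<comment> \<open>Replacing \<open>t\<close> by \<open>coord z + t\<close> turns the argument of
    \<open>F\<close> into a plain translate of \<open>z\<close>.\<close>
  have inner: "(\<integral>\<^sup>+t. F (z - coord z *\<^sub>R a + t *\<^sub>R a) * ennreal (?\<phi> t) \<partial>lborel)
        = (\<integral>\<^sup>+t. F (z + t *\<^sub>R a) * ennreal (?\<phi> (coord z + t)) \<partial>lborel)" for z
    by (subst nn_integral_lborel_translate[symmetric, where c = "coord z"])
       (auto simp: algebra_simps)
  have "?rhs = (\<integral>\<^sup>+z. (\<integral>\<^sup>+t. F (z + t *\<^sub>R a) * ennreal (?\<phi> (coord z + t)) \<partial>lborel) * ennreal (\<rho> z) \<partial>lborel)"
    by (simp only: inner)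
  also have "\<dots> = (\<integral>\<^sup>+z. (\<integral>\<^sup>+t. F (z + t *\<^sub>R a) * ennreal (?\<phi> (coord z + t)) * ennreal (\<rho> z) \<partial>lborel) \<partial>lborel)"
    by (intro nn_integral_cong nn_integral_multc[symmetric]) measurable
  also have "\<dots> = (\<integral>\<^sup>+t. (\<integral>\<^sup>+z. F (z + t *\<^sub>R a) * ennreal (?\<phi> (coord z + t)) * ennreal (\<rho> z) \<partial>lborel) \<partial>lborel)"
    by (rule lborel_pair.Fubini') measurable
  \<comment> \<open>For fixed \<open>t\<close>, translation invariance of Lebesgue measure moves the
    shift by \<open>t *\<^sub>R a\<close> from \<open>F\<close> to the density.\<close>
  also have "\<dots> = (\<integral>\<^sup>+t. (\<integral>\<^sup>+z. F z * ennreal (?\<phi> (coord z)) * ennreal (\<rho> (z - t *\<^sub>R a)) \<partial>lborel) \<partial>lborel)"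
  proof (rule nn_integral_cong)
    fix t
    show "(\<integral>\<^sup>+z. F (z + t *\<^sub>R a) * ennreal (?\<phi> (coord z + t)) * ennreal (\<rho> z) \<partial>lborel)
        = (\<integral>\<^sup>+z. F z * ennreal (?\<phi> (coord z)) * ennreal (\<rho> (z - t *\<^sub>R a)) \<partial>lborel)"
      by (subst (2) nn_integral_lborel_translate[symmetric, where c = "t *\<^sub>R a"])
         (auto simp: coord_a)
  qed
  also have "\<dots> = (\<integral>\<^sup>+z. (\<integral>\<^sup>+t. F z * ennreal (?\<phi> (coord z)) * ennreal (\<rho> (z - t *\<^sub>R a)) \<partial>lborel) \<partial>lborel)"
    by (rule lborel_pair.Fubini') measurable
  also have "\<dots> = (\<integral>\<^sup>+z. (\<integral>\<^sup>+t. F z * ennreal (\<rho> z)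
      * ennreal (normal_density (coord z - coord \<mu>) (1 / sqrt \<beta>) t) \<partial>lborel) \<partial>lborel)"
  proof -
    have "F z * ennreal (?\<phi> (coord z)) * ennreal (\<rho> (z - t *\<^sub>R a))
        = F z * ennreal (\<rho> z) * ennreal (normal_density (coord z - coord \<mu>) (1 / sqrt \<beta>) t)" for z t
    proof -
      have "ennreal (?\<phi> (coord z)) * ennreal (\<rho> (z - t *\<^sub>R a))
          = ennreal (\<rho> z) * ennreal (normal_density (coord z - coord \<mu>) (1 / sqrt \<beta>) t)"
        using \<rho>_nonneg by (simp only: ennreal_mult[symmetric] normal_density_nonneg key)
      then show ?thesis by (simp only: mult.assoc)
    qed
    then show ?thesis by simp
  qed
  also have "\<dots> = (\<integral>\<^sup>+z. F z * ennreal (\<rho> z) \<partial>lborel)"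
    by (subst nn_integral_cmult) (auto simp: mass)
  finally show ?thesis by simp
qed

section \<open>Quantiles of log-normal sums\<close>

locale multivariate_lognormal =
  fixes M :: "'a measure" and Z X :: "'a \<Rightarrow> real ^ 'n" and \<mu> :: "real ^ 'n" and A B :: "real ^ 'n ^ 'n"
  assumes M: "prob_space M"
    and A: "sym_pos_def A"
    and Z: "distributed M lborel Z (mvn_density \<mu> A)"
    and X: "\<And>\<omega> i. \<omega> \<in> space M \<Longrightarrow> X \<omega> $ i = exp (Z \<omega> $ i)"
    and B: "B = matrix_inv A"
begin

lemma A_invertible: "invertible A"
proof -
  have "v = 0" if "A *v v = 0" for v
  proof (rule ccontr)
    assume "v \<noteq> 0"
    then have "v \<bullet> (A *v v) > 0" using A unfolding sym_pos_def_def by blast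
    then show False using that by simp
  qed
  then show ?thesis
    unfolding invertible_left_inverse using matrix_left_invertible_ker[of A] by blast
qed

lemma A_B: "A ** B = mat 1" and B_A: "B ** A = mat 1"
proof -
  have "A ** B = mat 1 \<and> B ** A = mat 1"
    unfolding B matrix_inv_def using A_invertible unfolding invertible_def by (rule someI_ex)
  then show "A ** B = mat 1" "B ** A = mat 1" by blast+
qed

lemma B_sym: "transpose B = B"
proof -
  have "A ** transpose B = mat 1"
    using A B_A by (metis matrix_transpose_mul sym_pos_def_def transpose_mat)
  then have "B ** (A ** transpose B) = B" by simp
  then show ?thesis by (simp add: matrix_mul_assoc B_A)
qed

lemma B_pos: "v \<noteq> 0 \<Longrightarrow> v \<bullet> (B *v v) > 0"
proof -
  assume v: "v \<noteq> 0"
  have AB: "A *v (B *v v) = v" by (simp add: matrix_vector_mul_assoc A_B)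
  then have "B *v v \<noteq> 0" using v by auto
  then have "(B *v v) \<bullet> (A *v (B *v v)) > 0" using A unfolding sym_pos_def_def by blast
  then show ?thesis by (simp add: AB inner_commute)
qed

definition N :: "(real ^ 'n) measure" where "N = distr M lborel Z"

definition normalizer :: real where "normalizer = 1 / sqrt ((2 * pi) ^ CARD('n) * det A)"

lemma Z_measurable[measurable]: "Z \<in> borel_measurable M"
  using distributed_measurable[OF Z] by simp

lemma N_density: "N = density lborel (\<lambda>z. ennreal (normalizer * exp (- ((z - \<mu>) \<bullet> (B *v (z - \<mu>))) / 2)))"
  unfolding N_def distributed_distr_eq_density[OF Z] by (simp add: mvn_density_def normalizer_def B)

lemma prob_space_N: "prob_space N"
  unfolding N_def by (rule prob_space.prob_space_distr[OF M]) simp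

lemma sets_N [measurable_cong, simp]: "sets N = sets borel" and space_N [simp]: "space N = UNIV"
  by (simp_all add: N_def)

text \<open>For \<open>det A \<le> 0\<close> the normalizer is nonpositive (\<open>1 / 0 = 0\<close>), so the density would vanish
  as an extended nonnegative real.\<close>
lemma normalizer_pos: "normalizer > 0"
proof (rule ccontr)
  assume "\<not> normalizer > 0"
  then have "ennreal (normalizer * exp (- ((z - \<mu>) \<bullet> (B *v (z - \<mu>))) / 2)) = 0" for z
    by (intro ennreal_neg mult_nonpos_nonneg) auto
  then have "emeasure N (space N) = 0" unfolding N_density by (simp add: emeasure_density)
  then show False using prob_space.emeasure_space_1[OF prob_space_N] by simp
qed

lemma B_measurable[measurable]: "(*v) B \<in> borel_measurable borel"
  by (intro borel_measurable_continuous_onI linear_continuous_on) (rule matrix_vector_mul_bounded_linear)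

text \<open>The density is positive, so the relation holds Lebesgue almost everywhere and, by
  continuity, everywhere; the functions \<open>exp (z $ i)\<close> are linearly independent.
  Strictness in the concavity claim rests on this.\<close>

lemma AE_N_imp_all_exp_combination_zero:
  assumes "AE z in N. (\<Sum>i\<in>UNIV. c $ i * exp (z $ i)) = 0"
  shows "c = 0"
proof (rule ccontr)
  assume "c \<noteq> 0"
  then obtain j where j: "c $ j \<noteq> 0" by (auto simp: vec_eq_iff)
  let ?f = "\<lambda>z :: real ^ 'n. \<Sum>i\<in>UNIV. c $ i * exp (z $ i)"
  \<comment> \<open>Moving coordinate \<open>j\<close> from 0 to \<open>ln 2\<close> takes its
    exponential from 1 to 2, so the two values differ by exactly \<open>c $ j\<close>.\<close>
  have "?f (axis j (ln 2)) - ?f 0 = (\<Sum>i\<in>UNIV. if i = j then c $ j else 0)"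
    unfolding sum_subtractf[symmetric] by (intro sum.cong refl) (auto simp: axis_def)
  then have "?f (axis j (ln 2)) \<noteq> 0 \<or> ?f 0 \<noteq> 0" using j by auto
  then obtain z where z: "?f z \<noteq> 0" by blast
  let ?U = "{z. ?f z \<noteq> 0}"
  have op: "open ?U" by (intro open_Collect_neq continuous_intros)
  have "AE z in lborel. ?f z = 0"
    using assms normalizer_pos unfolding N_density by (subst (asm) AE_density) auto
  then have "emeasure lborel ?U = 0"
    using emeasure_eq_0_AE[of "\<lambda>z. ?f z \<noteq> 0" lborel] by simp
  then have "?U \<in> null_sets lborel" using op by (simp add: null_sets_def)
  then have "negligible ?U"
    unfolding negligible_iff_null_sets by (rule null_sets_completionI)
  then have "?U = {}" using op open_not_negligible by blast
  then show False using z by blast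
qed

lemma exp_sum_measurable [measurable]:
  "(\<lambda>\<omega>. \<Sum>i\<in>UNIV. u $ i * exp (Z \<omega> $ i)) \<in> borel_measurable M"
  by (rule measurable_compose[OF Z_measurable]) (intro borel_measurable_continuous_onI continuous_intros)

definition sum_cdf :: "real ^ 'n \<Rightarrow> real \<Rightarrow> real" where
  "sum_cdf u y = measure M {\<omega> \<in> space M. (\<Sum>i\<in>UNIV. u $ i * X \<omega> $ i) \<le> y}"

lemma sum_cdf_eq_cdf:
  "sum_cdf u y = cdf (distr M borel (\<lambda>\<omega>. \<Sum>i\<in>UNIV. u $ i * exp (Z \<omega> $ i))) y"
  unfolding cdf_def sum_cdf_def
  by (subst measure_distr) (auto simp: X intro!: arg_cong[where f = "measure M"])

lemma sum_cdf_mono: "x \<le> y \<Longrightarrow> sum_cdf u x \<le> sum_cdf u y"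
proof -
  interpret D: real_distribution "distr M borel (\<lambda>\<omega>. \<Sum>i\<in>UNIV. u $ i * exp (Z \<omega> $ i))"
    by (rule prob_space.real_distribution_distr[OF M]) simp
  show "x \<le> y \<Longrightarrow> sum_cdf u x \<le> sum_cdf u y"
    unfolding sum_cdf_eq_cdf by (rule D.cdf_nondecreasing)
qed

lemma sum_cdf_nonpos:
  assumes u: "\<And>i. u $ i > 0" and y: "y \<le> 0"
  shows "sum_cdf u y = 0"
proof -
  have "(\<Sum>i\<in>UNIV. u $ i * X \<omega> $ i) > 0" if "\<omega> \<in> space M" for \<omega>
    using u that by (intro sum_pos) (auto simp: X)
  then have "{\<omega> \<in> space M. (\<Sum>i\<in>UNIV. u $ i * X \<omega> $ i) \<le> y} = {}" using y by fastforce
  then show ?thesis unfolding sum_cdf_def by (metis measure_empty)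
qed

lemma sum_cdf_exceeds:
  assumes "\<alpha> < 1"
  shows "\<exists>y>0. sum_cdf u y > \<alpha>"
proof -
  interpret D: real_distribution "distr M borel (\<lambda>\<omega>. \<Sum>i\<in>UNIV. u $ i * exp (Z \<omega> $ i))"
    by (rule prob_space.real_distribution_distr[OF M]) simp
  have "\<forall>\<^sub>F y in at_top. sum_cdf u y > \<alpha>"
    unfolding sum_cdf_eq_cdf using D.cdf_lim_at_top_prob assms by (rule order_tendstoD(1))
  then have "\<forall>\<^sub>F y in at_top. sum_cdf u y > \<alpha> \<and> y > 0"
    using eventually_gt_at_top by (rule eventually_conj)
  then show ?thesis
    using eventually_happens[of _ "at_top :: real filter"] by fastforce
qed

text \<open>Right continuity at 0, where the distribution function vanishes because the sum is
  positive.\<close>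

lemma sum_cdf_small:
  assumes u: "\<And>i. u $ i > 0" and "\<alpha> > 0"
  shows "\<exists>y>0. sum_cdf u y < \<alpha>"
proof -
  interpret D: real_distribution "distr M borel (\<lambda>\<omega>. \<Sum>i\<in>UNIV. u $ i * exp (Z \<omega> $ i))"
    by (rule prob_space.real_distribution_distr[OF M]) simp
  have "(sum_cdf u \<longlongrightarrow> sum_cdf u 0) (at_right 0)"
    using D.cdf_is_right_cont[of 0] unfolding continuous_within sum_cdf_eq_cdf[abs_def] .
  then have "\<forall>\<^sub>F y in at_right 0. sum_cdf u y < \<alpha>"
    using assms sum_cdf_nonpos[of u 0] by (intro order_tendstoD(2)) auto
  then have "\<forall>\<^sub>F y in at_right 0. sum_cdf u y < \<alpha> \<and> y > 0"
    using eventually_at_right_less by (rule eventually_conj)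
  then show ?thesis
    using eventually_happens[of _ "at_right (0 :: real)"] by fastforce
qed

end

section \<open>Splitting the Gaussian vector along a positive direction\<close>

locale lognormal_direction = multivariate_lognormal M Z X \<mu> A B + positive_direction a
  for M :: "'a measure" and Z X :: "'a \<Rightarrow> real ^ 'n" and \<mu> :: "real ^ 'n" and A B :: "real ^ 'n ^ 'n"
    and a :: "real ^ 'n"
begin

definition prec :: real where "prec = a \<bullet> (B *v a)"

text \<open>The coefficient of the projection onto \<open>a\<close> that is orthogonal for the inner
  product with matrix \<open>B\<close>.\<close>

definition coord :: "real ^ 'n \<Rightarrow> real" where "coord z = ((B *v a) \<bullet> z) / prec"

definition residual :: "real ^ 'n \<Rightarrow> real ^ 'n" where "residual z = z - coord z *\<^sub>R a"

lemma prec_pos: "prec > 0"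
  unfolding prec_def using a_pos by (intro B_pos) (metis less_irrefl zero_index)

lemma coord_measurable [measurable]: "coord \<in> borel_measurable borel"
  unfolding coord_def[abs_def] by measurable

lemma residual_measurable: "residual \<in> borel_measurable N"
  unfolding residual_def[abs_def] by measurable

lemma residual_orthogonal: "(B *v a) \<bullet> residual z = 0"
  using prec_pos by (simp add: residual_def coord_def inner_diff_right prec_def inner_commute)

sublocale normal_mixture a prec "coord \<mu>" N residual
  by (intro normal_mixture.intro normal_level.intro normal_level_axioms.intro
      normal_mixture_axioms.intro prob_space_N residual_measurable prec_pos) unfold_locales

text \<open>\<open>gaussian_shift\<close> replaces \<open>coord z\<close> by an independent normal
  variable \<open>t\<close>. For a fixed residual the event is then
  \<open>t \<le> tau (l + residual z)\<close>, of probability \<open>normal_cdf\<close> at that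
  point.\<close>

lemma measure_exp_sum_le_1: "measure N {z. (\<Sum>i\<in>UNIV. exp (l $ i + z $ i)) \<le> 1} = mix_cdf l"
proof -
  let ?\<rho> = "\<lambda>z. normalizer * exp (- ((z - \<mu>) \<bullet> (B *v (z - \<mu>))) / 2)"
  let ?S = "{z :: real ^ 'n. (\<Sum>i\<in>UNIV. exp (l $ i + z $ i)) \<le> 1}"
  let ?c = "\<lambda>z. normal_cdf (coord \<mu>) (1 / sqrt prec) (tau (l + residual z))"
  have [measurable]: "?S \<in> sets borel" by measurable
  have cont: "continuous_on UNIV tau"
    using tau_has_derivative
    by (intro continuous_at_imp_continuous_on) (auto intro: has_derivative_continuous)
  have [measurable]: "tau \<in> borel_measurable borel"
    using cont by (rule borel_measurable_continuous_onI)
  have "continuous_on UNIV (normal_cdf (coord \<mu>) (1 / sqrt prec))"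
    using prec_pos by (intro continuous_at_imp_continuous_on ballI)
      (rule DERIV_isCont[OF normal_cdf_has_real_derivative], simp)
  then have [measurable]: "normal_cdf (coord \<mu>) (1 / sqrt prec) \<in> borel_measurable borel"
    by (rule borel_measurable_continuous_onI)
  have [measurable]: "residual \<in> borel_measurable borel"
    using residual_measurable by (simp cong: measurable_cong_sets)
  have "emeasure N ?S = (\<integral>\<^sup>+z. indicator ?S z * ennreal (?\<rho> z) \<partial>lborel)"
    unfolding N_density by (subst emeasure_density) (auto simp: mult.commute)
  also have "\<dots> = (\<integral>\<^sup>+z. (\<integral>\<^sup>+t. indicator ?S (z - coord z *\<^sub>R a + t *\<^sub>R a)
        * ennreal (normal_density (coord \<mu>) (1 / sqrt prec) t) \<partial>lborel) * ennreal (?\<rho> z) \<partial>lborel)"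
    unfolding prec_def coord_def
    using prec_pos[unfolded prec_def] normalizer_pos
    by (intro gaussian_shift B_sym) auto
  also have "\<dots> = (\<integral>\<^sup>+z. ennreal (?c z) * ennreal (?\<rho> z) \<partial>lborel)"
  proof -
    have "indicator ?S (z - coord z *\<^sub>R a + t *\<^sub>R a) = (indicator {..tau (l + residual z)} t :: ennreal)" for z t
      using exp_sum_le_1_iff[of "l + residual z" t]
      by (auto simp: indicator_def residual_def algebra_simps)
    then show ?thesis using prec_pos by (simp add: nn_integral_normal_density_le)
  qed
  also have "\<dots> = (\<integral>\<^sup>+z. ennreal (?c z) \<partial>N)"
    unfolding N_density by (subst nn_integral_density) (auto simp: mult.commute)
  also have "\<dots> = ennreal (mix_cdf l)"
    unfolding mix_cdf_def
    by (intro nn_integral_eq_integral has_derivative_integral_translate(2)[OF prob_space_N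
          residual_measurable bounded_C1_normal_cdf_tau]) (simp add: normal_cdf_bounds)
  finally show ?thesis
    by (simp add: measure_def mix_cdf_nonneg)
qed

lemma sum_cdf_eq_mix_cdf:
  assumes u: "\<And>i. u $ i > 0" and y: "y > 0"
  shows "sum_cdf u y = mix_cdf (\<chi> i. ln (u $ i) - ln y)"
proof -
  let ?l = "\<chi> i. ln (u $ i) - ln y"
  have eq: "(\<Sum>i\<in>UNIV. u $ i * exp (z $ i)) \<le> y \<longleftrightarrow> (\<Sum>i\<in>UNIV. exp (?l $ i + z $ i)) \<le> 1" for z
  proof -
    have "exp (?l $ i + z $ i) = u $ i * exp (z $ i) / y" for i
      using u[of i] y by (simp add: exp_add exp_diff)
    then show ?thesis using y by (simp flip: sum_divide_distrib)
  qed
  have "sum_cdf u y = measure M (Z -` {z. (\<Sum>i\<in>UNIV. exp (?l $ i + z $ i)) \<le> 1} \<inter> space M)"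
    unfolding sum_cdf_def eq[symmetric] by (intro arg_cong[where f = "measure M"]) (auto simp: X)
  also have "\<dots> = measure N {z. (\<Sum>i\<in>UNIV. exp (?l $ i + z $ i)) \<le> 1}"
    unfolding N_def by (subst measure_distr) auto
  finally show ?thesis by (simp only: measure_exp_sum_le_1)
qed

text \<open>On the logarithmic scale the distribution function is continuous and strictly
  increasing. The intermediate value theorem gives a point where it equals \<alpha>, and strictness
  makes that point the minimum of the set under \<open>Inf\<close>.\<close>

lemma quantile_level:
  assumes u: "\<And>i. u $ i > 0" and \<alpha>: "0 < \<alpha>" "\<alpha> < 1"
  defines "q \<equiv> Inf {y. sum_cdf u y \<ge> \<alpha>}"
  shows "q > 0" "mix_cdf (\<chi> i. ln (u $ i) - ln q) = \<alpha>"
proof -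
  obtain y1 where y1: "y1 > 0" "sum_cdf u y1 < \<alpha>" using sum_cdf_small[OF u \<alpha>(1)] by blast
  obtain y2 where y2: "y2 > 0" "sum_cdf u y2 > \<alpha>" using sum_cdf_exceeds[OF \<alpha>(2)] by blast
  let ?h = "\<lambda>t. mix_cdf (\<chi> i. ln (u $ i) - t)"
  have "y1 \<le> y2" using sum_cdf_mono[of y2 y1 u] y1 y2 by (cases "y1 \<le> y2") auto
  then have "ln y1 \<le> ln y2" using y1 by simp
  moreover have "continuous_on {ln y1..ln y2} ?h"
  proof -
    have "continuous_on UNIV mix_cdf"
      using mix_cdf_has_derivative
      by (intro continuous_at_imp_continuous_on) (auto intro: has_derivative_continuous)
    then show ?thesis
      by (rule continuous_on_compose2) (auto intro!: continuous_intros)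
  qed
  moreover have "?h (ln y1) \<le> \<alpha>" "\<alpha> \<le> ?h (ln y2)"
    using y1 y2 sum_cdf_eq_mix_cdf[OF u] by auto
  ultimately obtain t where t: "?h t = \<alpha>" using IVT'[of ?h "ln y1" \<alpha> "ln y2"] by blast
  have eq: "sum_cdf u (exp t) = \<alpha>" using sum_cdf_eq_mix_cdf[OF u] t by simp
  have "sum_cdf u y < \<alpha>" if "y < exp t" for y
  proof (cases "y > 0")
    case True
    then have "ln y < t" using that by (metis ln_exp ln_less_cancel_iff exp_gt_zero)
    then have "?h (ln y) < ?h t" by (intro mix_cdf_strict_antimono) simp
    then show ?thesis using sum_cdf_eq_mix_cdf[OF u True] t by simp
  next
    case False
    then show ?thesis using sum_cdf_nonpos[OF u] \<alpha>(1) by simp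
  qed
  then have "q = exp t"
    unfolding q_def using eq by (intro cInf_eq_minimum) (auto simp: not_less[symmetric])
  then show "q > 0" "mix_cdf (\<chi> i. ln (u $ i) - ln q) = \<alpha>" using t by simp_all
qed

end

section \<open>Comparison of quantiles at different levels\<close>

context multivariate_lognormal
begin

text \<open>Placed outside any choice of direction, since the two parts of the theorem use different
  ones.\<close>

definition quant :: "real \<Rightarrow> real ^ 'n \<Rightarrow> real" where
  "quant \<alpha> u = Inf {y. sum_cdf u y \<ge> \<alpha>}"

lemma quant_bdd_below:
  assumes "\<And>i. u $ i > 0" "\<alpha> > 0"
  shows "bdd_below {y. sum_cdf u y \<ge> \<alpha>}"
proof (rule bdd_belowI[of _ 0])
  fix y assume "y \<in> {y. sum_cdf u y \<ge> \<alpha>}"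
  then show "0 \<le> y"
    using sum_cdf_nonpos[OF assms(1), of y] assms(2) by (cases "y \<le> 0") auto
qed

lemma quant_le:
  assumes "\<And>i. u $ i > 0" "\<alpha> > 0" "\<alpha> \<le> sum_cdf u y"
  shows "quant \<alpha> u \<le> y"
  unfolding quant_def using assms by (intro cInf_lower quant_bdd_below) auto

lemma quant_mono:
  assumes u: "\<And>i. u $ i > 0" and \<alpha>: "0 < \<alpha>" "\<alpha> \<le> \<alpha>'" "\<alpha>' < 1"
  shows "quant \<alpha> u \<le> quant \<alpha>' u"
proof -
  obtain y where "sum_cdf u y > \<alpha>'" using sum_cdf_exceeds[OF \<alpha>(3)] by blast
  then have "{y. sum_cdf u y \<ge> \<alpha>'} \<noteq> {}" by (metis (mono_tags) empty_Collect_eq less_imp_le)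
  then show ?thesis
    unfolding quant_def using \<alpha> by (intro cInf_superset_mono quant_bdd_below u) auto
qed

end

section \<open>Sign of the Hessian form of the quantile\<close>

context lognormal_direction
begin

definition curvature :: "real ^ 'n \<Rightarrow> real ^ 'n \<Rightarrow> real" where
  "curvature \<delta> r = (\<Sum>i\<in>UNIV. \<delta> $ i * dens' i r \<delta>) - (\<Sum>i\<in>UNIV. (\<delta> $ i)\<^sup>2 * dens i r)"

lemma integrable_curvature [simp]: "integrable N (\<lambda>z. curvature \<delta> (l + residual z))"
  unfolding curvature_def by simp

context
  fixes \<alpha> :: real and u :: "real ^ 'n"
  assumes u: "\<And>i. u $ i > 0" and \<alpha>: "0 < \<alpha>" "\<alpha> < 1"
begin

abbreviation "base \<equiv> log_point (quant \<alpha>) u"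
abbreviation "dir v \<equiv> tangent (quant \<alpha>) u v"

lemma quant_pos: "(\<And>i. w $ i > 0) \<Longrightarrow> quant \<alpha> w > 0"
  unfolding quant_def by (rule quantile_level(1)) (use \<alpha> in auto)

lemma quant_level: "(\<And>i. w $ i > 0) \<Longrightarrow> mix_cdf (\<chi> i. ln (w $ i) - ln (quant \<alpha> w)) = \<alpha>"
  unfolding quant_def by (rule quantile_level(2)) (use \<alpha> in auto)

lemma dir_orthogonal: "(\<Sum>i\<in>UNIV. dir v $ i * mix_dens i base) = 0"
  by (rule tangent_orthogonal[of "quant \<alpha>" \<alpha>]) (use u quant_pos quant_level in auto)

lemma quant_hessian:
  "\<exists>H. has_hessian (quant \<alpha>) H u \<and> (\<forall>v. v \<bullet> (H *v v) =
    quant \<alpha> u / (\<Sum>i\<in>UNIV. mix_dens i base) * (\<integral>z. curvature (dir v) (base + residual z) \<partial>N))"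
  unfolding curvature_def mix_dens_second_order[symmetric]
  by (rule level_hessian[of "quant \<alpha>" \<alpha>]) (use u quant_pos quant_level in auto)

lemma quant_hessian_factor_pos: "quant \<alpha> u / (\<Sum>i\<in>UNIV. mix_dens i base) > 0"
  by (intro divide_pos_pos quant_pos u sum_pos mix_dens_pos) auto

lemma base_nth: "base $ i = ln (u $ i) - ln (quant \<alpha> u)"
  by (simp add: log_point_def)

text \<open>With all entries of \<open>a\<close> equal to 1, both \<open>mean_a\<close> and the
  second moment are 1 and the mixed sum equals \<open>?P\<close>, so the integrand collapses to a
  negative factor times a square. The bound on the quantile fixes the sign of that factor.\<close>

lemma strictly_concave_at_quant:
  assumes a1: "\<And>i. a $ i = 1" and b: "\<And>i. (B *v a) $ i > 0"
    and bound: "\<And>i. ln (quant \<alpha> u) - ln (u $ i) < coord \<mu> + 1 / prec"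
  shows "strictly_concave_at (quant \<alpha>) u"
proof -
  let ?P = "\<lambda>\<delta> r. \<Sum>i\<in>UNIV. \<delta> $ i * weight r i"
  let ?x = "\<lambda>z. base + residual z"
  have curv: "curvature \<delta> r = - (phi (tau r) * (1 - prec * (tau r - coord \<mu>)) * (?P \<delta> r)\<^sup>2)" for \<delta> r
  proof -
    have "mean_a r = 1" using sum_weight[of r] by (simp add: mean_a_def a1)
    then show ?thesis unfolding curvature_def dens_second_order
      by (simp add: a1 sum_weight power2_eq_square algebra_simps)
  qed
  have neg: "1 - prec * (tau (?x z) - coord \<mu>) > 0" for z
  proof -
    \<comment> \<open>Averaging \<open>tau_upper\<close> over all indices with the positive weights
      \<open>(B *v a) $ i\<close> makes the residual drop out, so the bound is uniform in
      \<open>z\<close>.\<close>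
    have "prec * tau (?x z) = (\<Sum>i\<in>UNIV. (B *v a) $ i * (tau (?x z) * a $ i))"
      by (simp add: prec_def inner_vec_def sum_distrib_right sum_distrib_left ac_simps)
    also have "\<dots> \<le> (\<Sum>i\<in>UNIV. (B *v a) $ i * (- ?x z $ i))"
      using b by (intro sum_mono mult_left_mono tau_upper) (auto simp: less_imp_le)
    also have "\<dots> = (\<Sum>i\<in>UNIV. (B *v a) $ i * (ln (quant \<alpha> u) - ln (u $ i))) - (B *v a) \<bullet> residual z"
      by (simp add: inner_vec_def base_nth sum_subtractf[symmetric] algebra_simps)
    also have "\<dots> < (\<Sum>i\<in>UNIV. (B *v a) $ i * (coord \<mu> + 1 / prec))"
      unfolding residual_orthogonal using b bound by (auto intro!: sum_strict_mono)
    also have "\<dots> = prec * (coord \<mu> + 1 / prec)"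
      by (simp add: prec_def inner_vec_def a1 sum_distrib_right)
    also have "\<dots> = prec * coord \<mu> + 1" using prec_pos by (simp add: field_simps)
    finally show ?thesis by (simp add: algebra_simps)
  qed
  have nonpos: "curvature \<delta> (?x z) \<le> 0" for \<delta> z
    unfolding curv using neg[of z] phi_pos[of "tau (?x z)"] by (simp add: less_imp_le)
  obtain H where H: "has_hessian (quant \<alpha>) H u"
    and quad: "\<And>v. v \<bullet> (H *v v) = quant \<alpha> u / (\<Sum>i\<in>UNIV. mix_dens i base)
        * (\<integral>z. curvature (dir v) (?x z) \<partial>N)"
    using quant_hessian by blast
  have le: "(\<integral>z. curvature \<delta> (?x z) \<partial>N) \<le> 0" for \<delta>
    using integral_mono[of N "\<lambda>z. curvature \<delta> (?x z)" "\<lambda>_. 0"] nonpos by simp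
  have less: "(\<integral>z. curvature (dir v) (?x z) \<partial>N) < 0" if v: "\<nexists>c. v = c *\<^sub>R u" for v
  proof (rule ccontr)
    assume "\<not> (\<integral>z. curvature (dir v) (?x z) \<partial>N) < 0"
    then have "(\<integral>z. - curvature (dir v) (?x z) \<partial>N) = 0" using le[of "dir v"] by simp
    then have "AE z in N. - curvature (dir v) (?x z) = 0"
      using nonpos by (subst (asm) integral_nonneg_eq_0_iff_AE) auto
    then have "AE z in N. (\<Sum>i\<in>UNIV. (\<chi> i. dir v $ i * exp (base $ i)) $ i * exp (z $ i)) = 0"
    proof eventually_elim
      fix z assume "- curvature (dir v) (?x z) = 0"
      then have "?P (dir v) (?x z) = 0"
        using neg[of z] phi_pos[of "tau (?x z)"] by (simp add: curv)
      \<comment> \<open>The residual and \<open>tau\<close> enter every weight through the same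
        factor, so \<open>?P = 0\<close> is a linear relation between the
        \<open>exp (z $ i)\<close>.\<close>
      moreover have "weight (?x z) i = exp (base $ i) * exp (z $ i) * exp (tau (?x z) - coord z)" for i
        unfolding weight_def exp_add[symmetric] by (simp add: residual_def a1)
      then have "?P (dir v) (?x z) = (\<Sum>i\<in>UNIV. dir v $ i * exp (base $ i) * exp (z $ i))
          * exp (tau (?x z) - coord z)"
        by (simp add: sum_distrib_right mult.assoc)
      ultimately show "(\<Sum>i\<in>UNIV. (\<chi> i. dir v $ i * exp (base $ i)) $ i * exp (z $ i)) = 0"
        by simp
    qed
    then have "(\<chi> i. dir v $ i * exp (base $ i)) = 0"
      by (rule AE_N_imp_all_exp_combination_zero)
    then have zero: "dir v $ i = 0" for i by (simp add: vec_eq_iff)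
    \<comment> \<open>A vanishing tangent vector means that \<open>v $ i / u $ i\<close> does not
      depend on \<open>i\<close>.\<close>
    have "v $ i = level_deriv (quant \<alpha>) u v / quant \<alpha> u * u $ i" for i
      using zero[of i] u[of i] by (simp add: tangent_def field_simps)
    then have "v = (level_deriv (quant \<alpha>) u v / quant \<alpha> u) *\<^sub>R u" by (simp add: vec_eq_iff)
    then show False using v by blast
  qed
  show ?thesis
    unfolding strictly_concave_at_def
    using H quad le less quant_hessian_factor_pos
    by (metis mult_nonneg_nonpos mult_pos_neg less_imp_le)
qed

text \<open>Notation of \<open>dens_second_order\<close>, \<open>D\<close> being \<open>mean_a\<close>. The mixed term \<open>S P / D\<^sup>2\<close> has no
  sign by itself. If \<open>w\<close> is the weight of \<open>k\<close> and \<open>m\<close> its mean, then \<open>P\<close> and \<open>S / D - g\<close>, where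
  \<open>g\<close> is the value of \<open>S / D\<close> at \<open>w = m\<close>, are both positive multiples of \<open>\<Delta> (w - m)\<close>, while the
  constant \<open>g\<close> does not contribute because \<open>phi P / D\<close> integrates to zero (\<open>dir_orthogonal\<close>).\<close>
lemma concave_at_quant:
  assumes univ: "UNIV = {i, k}" "i \<noteq> k" and Ba: "B *v a = axis i 1"
    and small: "ln (quant \<alpha> u) \<le> ln (u $ i) + prec * coord \<mu> - (a $ i + a $ k)"
  shows "concave_at (quant \<alpha>) u"
proof -
  let ?x = "\<lambda>z. base + residual z"
  have sum2: "(\<Sum>j\<in>UNIV. f j) = f i + f k" for f :: "'n \<Rightarrow> real"
    by (subst univ) (simp add: univ(2))
  obtain H where H: "has_hessian (quant \<alpha>) H u"
    and quad: "\<And>v. v \<bullet> (H *v v) = quant \<alpha> u / (\<Sum>i\<in>UNIV. mix_dens i base)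
        * (\<integral>z. curvature (dir v) (?x z) \<partial>N)"
    using quant_hessian by blast
  have "(\<integral>z. curvature (dir v) (?x z) \<partial>N) \<le> 0" for v
  proof -
    define \<delta> where "\<delta> = dir v"
    define m where "m = mix_dens k base / (mix_dens i base + mix_dens k base)"
    define \<Delta> where "\<Delta> = \<delta> $ k - \<delta> $ i"
    define Dm where "Dm = a $ i * (1 - m) + a $ k * m"
    define g where "g = \<Delta> * m * (1 - m) * (a $ k - a $ i) / Dm"
    have m: "0 < m" "m < 1"
      using mix_dens_pos[of i base] mix_dens_pos[of k base] by (simp_all add: m_def)
    have Dm: "Dm > 0" unfolding Dm_def using m a_pos by (simp add: add_pos_pos)
    have orth: "\<delta> $ i * mix_dens i base + \<delta> $ k * mix_dens k base = 0"
      using dir_orthogonal[of v] by (simp add: sum2 \<delta>_def)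
    have "mix_dens i base + mix_dens k base > 0"
      using mix_dens_pos[of i base] mix_dens_pos[of k base] by simp
    \<comment> \<open>Orthogonality leaves one degree of freedom, the difference
      \<open>\<Delta>\<close>.\<close>
    then have \<delta>i: "\<delta> $ i = - \<Delta> * m" and \<delta>k: "\<delta> $ k = \<Delta> * (1 - m)"
      using orth by (simp_all add: m_def \<Delta>_def field_simps)
    have point: "curvature \<delta> (?x z) \<le> - 2 * g * (\<Sum>j\<in>UNIV. \<delta> $ j * dens j (?x z))" for z
    proof -
      define r where "r = ?x z"
      define w where "w = weight r k"
      define D where "D = mean_a r"
      define P where "P = \<Delta> * (w - m)"
      define S where "S = (\<Sum>i\<in>UNIV. a $ i * \<delta> $ i * weight r i)"
      define E where "E = (\<Sum>i\<in>UNIV. (a $ i)\<^sup>2 * weight r i)"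
      have wi: "weight r i = 1 - w" using sum_weight[of r] by (simp add: sum2 w_def)
      have w: "0 < w" "0 < 1 - w" using weight_pos[of r] wi[symmetric] by (simp_all add: w_def)
      have D: "D = a $ i * (1 - w) + a $ k * w" by (simp add: D_def mean_a_def sum2 wi w_def)
      have Dpos: "D > 0" unfolding D_def by (rule mean_a_pos)
      have P: "(\<Sum>i\<in>UNIV. \<delta> $ i * weight r i) = P"
        by (simp add: P_def sum2 wi \<delta>i \<delta>k w_def[symmetric] algebra_simps)
      have S: "S = - a $ i * \<Delta> * m * (1 - w) + a $ k * \<Delta> * (1 - m) * w"
        by (simp add: S_def sum2 wi \<delta>i \<delta>k w_def[symmetric])
      \<comment> \<open>Cross-multiplied form of the difference between \<open>S / D\<close> and its
        value \<open>g\<close> at \<open>w = m\<close>.\<close>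
      have "S * Dm - \<Delta> * m * (1 - m) * (a $ k - a $ i) * D = a $ i * a $ k * P"
        unfolding S Dm_def D P_def by (simp add: algebra_simps)
      then have SD: "S / D = g + a $ i * a $ k * P / (D * Dm)"
        using Dpos Dm unfolding g_def by (simp add: field_simps)
      \<comment> \<open>\<open>E / D\<close> is a weighted mean of \<open>a $ i\<close> and
        \<open>a $ k\<close>; their sum bounds it without deciding which is larger.\<close>
      have E_le: "E / D \<le> a $ i + a $ k"
      proof -
        have "E = a $ i * (a $ i * (1 - w)) + a $ k * (a $ k * w)"
          by (simp add: E_def sum2 wi w_def[symmetric] power2_eq_square)
        also have "\<dots> \<le> (a $ i + a $ k) * (a $ i * (1 - w)) + (a $ i + a $ k) * (a $ k * w)"
          using a_pos[of i] a_pos[of k] w by (intro add_mono mult_right_mono) auto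
        also have "\<dots> = (a $ i + a $ k) * D" by (simp add: D algebra_simps)
        finally show ?thesis using Dpos by (simp add: field_simps)
      qed
      \<comment> \<open>Since \<open>B *v a\<close> is a unit vector, coordinate \<open>i\<close> of
        the residual vanishes, and \<open>tau_upper\<close> at \<open>i\<close> gives a bound free
        of \<open>z\<close>.\<close>
      have "prec * tau r \<le> ln (quant \<alpha> u) - ln (u $ i)"
      proof -
        have "residual z $ i = 0" using residual_orthogonal[of z] by (simp add: Ba inner_axis')
        moreover have "prec = a $ i" by (simp add: prec_def Ba inner_axis)
        ultimately show ?thesis
          using tau_upper[of r i] by (simp add: r_def base_nth mult.commute)
      qed
      then have coeff: "prec * (tau r - coord \<mu>) + E / D \<le> 0"
        using small E_le by (simp add: algebra_simps)
      have "curvature \<delta> r = phi (tau r) * ((prec * (tau r - coord \<mu>) + E / D) * (P / D)\<^sup>2 - 2 * S * P / D\<^sup>2)"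
        unfolding curvature_def dens_second_order P by (simp add: S_def E_def D_def)
      also have "2 * S * P / D\<^sup>2 = 2 * (P / D) * (S / D)" by (simp add: power2_eq_square)
      also have "\<dots> = 2 * g * (P / D) + 2 * (a $ i * a $ k / Dm) * (P / D)\<^sup>2"
        unfolding SD using Dpos Dm by (simp add: field_simps power2_eq_square)
      also have "phi (tau r) * ((prec * (tau r - coord \<mu>) + E / D) * (P / D)\<^sup>2 -
          (2 * g * (P / D) + 2 * (a $ i * a $ k / Dm) * (P / D)\<^sup>2)) \<le> phi (tau r) * (- (2 * g * (P / D)))"
      proof (intro mult_left_mono)
        have "(prec * (tau r - coord \<mu>) + E / D) * (P / D)\<^sup>2 \<le> 0"
          using coeff by (intro mult_nonpos_nonneg) auto
        moreover have "0 \<le> 2 * (a $ i * a $ k / Dm) * (P / D)\<^sup>2"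
          using a_pos[of i] a_pos[of k] Dm by simp
        ultimately show "(prec * (tau r - coord \<mu>) + E / D) * (P / D)\<^sup>2 -
          (2 * g * (P / D) + 2 * (a $ i * a $ k / Dm) * (P / D)\<^sup>2) \<le> - (2 * g * (P / D))" by linarith
      qed (use phi_pos[of "tau r"] in simp)
      also have "\<dots> = - 2 * g * (\<Sum>j\<in>UNIV. \<delta> $ j * dens j r)"
        unfolding P[symmetric] by (simp add: dens_def D_def sum2 divide_inverse algebra_simps)
      finally show ?thesis by (simp add: r_def)
    qed
    have "(\<integral>z. curvature \<delta> (?x z) \<partial>N) \<le> (\<integral>z. - 2 * g * (\<Sum>j\<in>UNIV. \<delta> $ j * dens j (?x z)) \<partial>N)"
      by (rule integral_mono) (use point in simp_all)
    also have "\<dots> = - 2 * g * (\<Sum>j\<in>UNIV. \<delta> $ j * mix_dens j base)"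
      by (simp add: mix_dens_def)
    also have "\<dots> = 0" using dir_orthogonal[of v] by (simp add: \<delta>_def)
    finally show ?thesis by (simp add: \<delta>_def)
  qed
  then show ?thesis
    unfolding concave_at_def using H quad quant_hessian_factor_pos
    by (metis mult_nonneg_nonpos less_imp_le)
qed

end

end

section \<open>Choice of direction and of the level in the two claims\<close>

theorem theorem3p6:
  fixes M :: "'a measure"
    and Z X :: "'a \<Rightarrow> real ^ 'n"
    and \<mu> b u :: "real ^ 'n"
    and A B :: "real ^ 'n ^ 'n"
    and \<beta> :: real
    and q :: "real \<Rightarrow> real ^ 'n \<Rightarrow> real"
  assumes "CARD('n) \<ge> 2"
    and "prob_space M"
    and "sym_pos_def A"
    and "distributed M lborel Z (mvn_density \<mu> A)"
    and "\<And>\<omega> i. \<omega> \<in> space M \<Longrightarrow> X \<omega> $ i = exp (Z \<omega> $ i)"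
    and "B = matrix_inv A"
    and "\<And>i. b $ i = (\<Sum>j\<in>UNIV. B $ j $ i)"
    and "\<beta> = (\<Sum>i\<in>UNIV. b $ i)"
    and "\<And>\<alpha> w. q \<alpha> w = quantile M (\<lambda>\<omega>. \<Sum>i\<in>UNIV. w $ i * X \<omega> $ i) \<alpha>"
    and "\<And>i. u $ i > 0"
  shows "((\<forall>i. b $ i > 0) \<longrightarrow>
           (\<forall>\<alpha>\<^sub>0. 0 < \<alpha>\<^sub>0 \<and> \<alpha>\<^sub>0 < 1 \<and>
              (\<exists>\<eta>. 0 < \<eta> \<and> \<eta> < Min (range (\<lambda>i. u $ i)) \<and>
                   q \<alpha>\<^sub>0 u < \<eta> * exp (1 / \<beta> * ((\<Sum>j\<in>UNIV. (B *v \<mu>) $ j) + 1))) \<longrightarrow>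
              (\<forall>\<alpha>. 0 < \<alpha> \<and> \<alpha> \<le> \<alpha>\<^sub>0 \<longrightarrow> strictly_concave_at (q \<alpha>) u)))
       \<and> (\<forall>k. CARD('n) = 2 \<and> b $ k < 0 \<longrightarrow>
           (\<exists>\<alpha>\<^sub>0. 0 < \<alpha>\<^sub>0 \<and> \<alpha>\<^sub>0 < 1 \<and>
              (\<forall>\<alpha>. 0 < \<alpha> \<and> \<alpha> \<le> \<alpha>\<^sub>0 \<longrightarrow> concave_at (q \<alpha>) u)))"
proof (intro conjI impI allI)
  interpret multivariate_lognormal M Z X \<mu> A B
    using assms(2-6) by (intro multivariate_lognormal.intro) auto
  have q: "q \<alpha> = quant \<alpha>" for \<alpha>
    by (simp add: fun_eq_iff assms(9) quantile_def quant_def sum_cdf_def)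
  have u: "\<And>i. u $ i > 0" by (rule assms(10))
  {
    fix \<alpha>\<^sub>0 \<alpha>
    assume b: "\<forall>i. b $ i > 0"
      and \<alpha>\<^sub>0: "0 < \<alpha>\<^sub>0 \<and> \<alpha>\<^sub>0 < 1 \<and> (\<exists>\<eta>. 0 < \<eta> \<and> \<eta> < Min (range (\<lambda>i. u $ i)) \<and>
        q \<alpha>\<^sub>0 u < \<eta> * exp (1 / \<beta> * ((\<Sum>j\<in>UNIV. (B *v \<mu>) $ j) + 1)))"
      and \<alpha>: "0 < \<alpha> \<and> \<alpha> \<le> \<alpha>\<^sub>0"
    interpret lognormal_direction M Z X \<mu> A B 1
      by unfold_locales simp
    \<comment> \<open>\<open>b\<close> consists of column sums of \<open>B\<close>; symmetry turns
      them into the row sums \<open>B *v 1\<close>.\<close>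
    have "B *v 1 = transpose B *v 1" by (simp only: B_sym)
    then have b_eq: "B *v 1 = b"
      by (simp add: vec_eq_iff assms(7) matrix_vector_mult_def transpose_def)
    have prec: "prec = \<beta>" by (simp add: prec_def b_eq assms(8) inner_vec_def)
    have "(\<Sum>j\<in>UNIV. (B *v \<mu>) $ j) = 1 \<bullet> (B *v \<mu>)" by (simp add: inner_vec_def)
    also have "\<dots> = prec * coord \<mu>"
      using prec_pos inner_matrix_symmetric[OF B_sym, of 1 \<mu>] by (simp add: coord_def)
    finally have mean: "1 / \<beta> * ((\<Sum>j\<in>UNIV. (B *v \<mu>) $ j) + 1) = coord \<mu> + 1 / prec"
      using prec_pos by (simp add: prec[symmetric] field_simps)
    from \<alpha>\<^sub>0 obtain \<eta> where \<eta>: "0 < \<eta>" "\<eta> < Min (range (\<lambda>i. u $ i))"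
      and less: "quant \<alpha>\<^sub>0 u < \<eta> * exp (coord \<mu> + 1 / prec)"
      unfolding mean q by blast
    have \<alpha>1: "0 < \<alpha>" "\<alpha> < 1" using \<alpha> \<alpha>\<^sub>0 by auto
    have qpos: "quant \<alpha> u > 0" by (rule quant_pos) (use \<alpha>1 u in auto)
    have "quant \<alpha> u \<le> quant \<alpha>\<^sub>0 u" using \<alpha> \<alpha>\<^sub>0 by (intro quant_mono u) auto
    then have "quant \<alpha> u < \<eta> * exp (coord \<mu> + 1 / prec)" using less by linarith
    then have "ln (quant \<alpha> u) < ln (\<eta> * exp (coord \<mu> + 1 / prec))"
      using qpos \<eta> by (subst ln_less_cancel_iff) auto
    also have "\<dots> = ln \<eta> + (coord \<mu> + 1 / prec)" using \<eta> by (simp add: ln_mult)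
    finally have "ln (quant \<alpha> u) < ln \<eta> + (coord \<mu> + 1 / prec)" .
    moreover have "ln \<eta> < ln (u $ i)" for i
      using \<eta> u by (subst ln_less_cancel_iff) auto
    ultimately have "ln (quant \<alpha> u) - ln (u $ i) < coord \<mu> + 1 / prec" for i
      by (smt (verit))
    then show "strictly_concave_at (q \<alpha>) u"
      unfolding q by (intro strictly_concave_at_quant u \<alpha>1) (use b b_eq in auto)
  }
  {
    fix k assume k: "CARD('n) = 2 \<and> b $ k < 0"
    then obtain x y :: 'n where xy: "UNIV = {x, y}" "x \<noteq> y"
      unfolding card_2_iff by blast
    define i where "i = (if k = x then y else x)"
    have "k \<in> {x, y}" using xy(1) by blast
    then have univ: "UNIV = {i, k}" and ik: "i \<noteq> k"
      using xy by (auto simp: i_def)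
    have sum2: "(\<Sum>j\<in>UNIV. f j) = f i + f k" for f :: "'n \<Rightarrow> real"
      by (subst univ) (simp add: ik)
    \<comment> \<open>\<open>B\<close> sends this column of the covariance matrix to a unit vector,
      so \<open>coord\<close> depends on coordinate \<open>i\<close> alone.\<close>
    define a where "a = A *v axis i 1"
    have Ba: "B *v a = axis i 1" by (simp add: a_def matrix_vector_mul_assoc B_A)
    have "axis i 1 \<bullet> (A *v axis i 1) > 0"
      using A unfolding sym_pos_def_def by (auto simp: axis_eq_0_iff)
    then have ai: "a $ i > 0" by (simp add: a_def inner_axis')
    have "axis k 1 \<bullet> (B *v axis k 1) > 0" by (rule B_pos) (simp add: axis_eq_0_iff)
    then have Bkk: "B $ k $ k > 0"
      by (simp add: inner_axis' matrix_vector_mult_basis column_def)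
    have "transpose B $ k $ i = B $ i $ k" by (simp add: transpose_def)
    then have "B $ k $ i = B $ i $ k" by (simp only: B_sym)
    \<comment> \<open>\<open>b $ k < 0\<close> says that column \<open>k\<close> of \<open>B\<close>
      has negative sum. As its diagonal entry is positive, the other entry is negative, and row
      \<open>k\<close> of \<open>B *v a = axis i 1\<close> then forces
      \<open>a $ k > 0\<close>.\<close>
    then have Bki: "B $ k $ i < - B $ k $ k" using k assms(7)[of k] by (simp add: sum2)
    have "(B *v a) $ k = 0" using ik by (simp add: Ba axis_def)
    then have "B $ k $ k * a $ k = - B $ k $ i * a $ i"
      by (simp add: matrix_vector_mult_def sum2)
    also have "\<dots> > 0" using Bki Bkk ai by (intro mult_pos_pos) linarith+
    finally have ak: "a $ k > 0" using Bkk by (simp add: zero_less_mult_iff)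
    have a_pos: "a $ j > 0" for j
    proof -
      have "j \<in> {i, k}" unfolding univ[symmetric] by simp
      then show ?thesis using ai ak by auto
    qed
    interpret lognormal_direction M Z X \<mu> A B a
      by unfold_locales (rule a_pos)
    \<comment> \<open>The value of the quantile at which the smallness condition of
      \<open>concave_at_quant\<close> is an equality.\<close>
    define y\<^sub>0 where "y\<^sub>0 = u $ i * exp (prec * coord \<mu> - (a $ i + a $ k))"
    have y\<^sub>0: "y\<^sub>0 > 0" using u by (simp add: y\<^sub>0_def)
    define l where "l = (\<chi> j. ln (u $ j) - ln y\<^sub>0)"
    \<comment> \<open>Comparison with any larger argument shows that the nonnegative
      \<open>mix_cdf\<close> is in fact positive at \<open>l\<close>.\<close>
    have "mix_cdf (l + 1) < mix_cdf l" by (rule mix_cdf_strict_antimono) simp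
    then have pos: "sum_cdf u y\<^sub>0 > 0"
      using mix_cdf_nonneg[of "l + 1"] sum_cdf_eq_mix_cdf[OF u y\<^sub>0] by (simp add: l_def)
    show "\<exists>\<alpha>\<^sub>0. 0 < \<alpha>\<^sub>0 \<and> \<alpha>\<^sub>0 < 1 \<and> (\<forall>\<alpha>. 0 < \<alpha> \<and> \<alpha> \<le> \<alpha>\<^sub>0 \<longrightarrow> concave_at (q \<alpha>) u)"
    \<comment> \<open>Levels up to \<open>sum_cdf u y\<^sub>0\<close> have quantile at most
      \<open>y\<^sub>0\<close>; the minimum with \<open>1 / 2\<close> keeps the level below
      1.\<close>
    proof (intro exI[of _ "min (sum_cdf u y\<^sub>0) (1 / 2)"] conjI allI impI)
      fix \<alpha> assume \<alpha>: "0 < \<alpha> \<and> \<alpha> \<le> min (sum_cdf u y\<^sub>0) (1 / 2)"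
      then have \<alpha>1: "0 < \<alpha>" "\<alpha> < 1" by auto
      have "quant \<alpha> u > 0" by (rule quant_pos) (use \<alpha>1 u in auto)
      moreover have "quant \<alpha> u \<le> y\<^sub>0" using \<alpha> by (intro quant_le u) auto
      ultimately have "ln (quant \<alpha> u) \<le> ln y\<^sub>0" using y\<^sub>0 by simp
      also have "\<dots> = ln (u $ i) + prec * coord \<mu> - (a $ i + a $ k)"
        using u[of i] by (simp add: y\<^sub>0_def ln_mult)
      finally show "concave_at (q \<alpha>) u"
        unfolding q by (intro concave_at_quant[where i = i and k = k] u \<alpha>1 univ ik Ba)
    qed (use pos in auto)
  }
qed

end
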